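(* Let $\mathcal{H}$ be a Hilbert space, let $F\colon \mathcal{H}\rightrightarrows\mathcal{H}$ be a set-valued mapping, let $(\bar x,\bar y)\in \operatorname{gph} F$ and let $\kappa\in \mathbb{R}$. Then $F-\kappa\,\mathrm{Id}$ is locally maximal monotone at $(\bar x,\bar y-\kappa\bar x)$ if and only if $DF$ is $\kappa$-lower-definite around $(\bar x,\bar y)$ and $F$ is locally maximal hypomonotone at $(\bar x,\bar y)$.
   Context: Hilbert spaces are real, with inner product $\langle\cdot,\cdot\rangle$ and norm $\|\cdot\|$. For $F\colon\mathcal{H}\rightrightarrows\mathcal{H}$, $\operatorname{gph}F=\{(x,y): y\in F(x)\}$. $F$ is locally monotone at $(\bar x,\bar y)\in\operatorname{gph}F$ if there are neighborhoods $U,V$ of $\bar x,\bar y$ such that $\langle y-y',x-x'\rangle\ge 0$ for all $(x,y),(x',y')\in\operatorname{gph}F\cap(U\times V)$. A globally monotone operator satisfies this inequality on its whole graph. $F$ is locally maximal monotone at $(\bar x,\bar y)$ if $F$ is locally monotone at $(\bar x,\bar y)$ and there is a neighborhood $U\times V$ of $(\bar x,\bar y)$ such that for every globally monotone $S\colon\mathcal{H}\rightrightarrows\mathcal{H}$ with $\operatorname{gph}F\cap (U\times V)\subset\operatorname{gph}S$ one has $\operatorname{gph}F\cap (U\times V)=\operatorname{gph}S\cap (U\times V)$. $F$ is locally maximal hypomonotone at $(\bar x,\bar y)$ if there is $\rho>0$ such that $F+\rho\,\mathrm{Id}$ is locally maximal monotone at $(\bar x,\bar y+\rho\bar x)$.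 Graphical derivative: for $(x,y)\in\operatorname{gph}F$, $v\in DF(x,y)(u)$ iff there are $s_k\searrow0$ ($s_k>0$) and $(u_k,v_k)\to(u,v)$ with $(x,y)+s_k(u_k,v_k)\in\operatorname{gph}F$ for all $k$. $DF$ is $\kappa$-lower-definite around $(\bar x,\bar y)$ if there is a neighborhood $A$ of $(\bar x,\bar y)$ such that for all $(x,y)\in A\cap\operatorname{gph}F$, all $u\in\mathcal{H}$ and all $v\in DF(x,y)(u)$ one has $\langle u,v\rangle\ge\kappa\|u\|^2$.
   Formalization: In "locally maximal monotone", the neighborhood U×V in the maximality condition is required to be one on which F is monotone; with unrelated neighborhoods the condition can hold vacuously and the claim fails, e.g. gph F = {(0,0),(1,0)} in R, κ = 1, at (0,0). *)

theory Defs
  imports "HOL-Analysis.Analysis"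
begin

text \<open>A set-valued mapping is a function of type \<open>'a \<Rightarrow> 'a set\<close>. Throughout, \<open>N\<close> is a neighborhood
  of \<open>p\<close> (not necessarily open) iff \<open>p \<in> interior N\<close>.\<close>

definition gph :: "('a \<Rightarrow> 'b set) \<Rightarrow> ('a \<times> 'b) set" where
  "gph F = {(x, y). y \<in> F x}"

definition plus_scaled_id :: "('a::real_vector \<Rightarrow> 'a set) \<Rightarrow> real \<Rightarrow> 'a \<Rightarrow> 'a set" where
  "plus_scaled_id F r = (\<lambda>x. {y + r *\<^sub>R x | y. y \<in> F x})"

definition monotone_set :: "('a::real_inner \<times> 'a) set \<Rightarrow> bool" where
  "monotone_set G \<longleftrightarrow> (\<forall>(x, y) \<in> G. \<forall>(x', y') \<in> G. inner (y - y') (x - x') \<ge> 0)"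

definition globally_monotone :: "('a::real_inner \<Rightarrow> 'a set) \<Rightarrow> bool" where
  "globally_monotone S \<longleftrightarrow> monotone_set (gph S)"

definition locally_monotone_at :: "('a::real_inner \<Rightarrow> 'a set) \<Rightarrow> 'a \<Rightarrow> 'a \<Rightarrow> bool" where
  "locally_monotone_at F xb yb \<longleftrightarrow>
     (\<exists>U V. xb \<in> interior U \<and> yb \<in> interior V \<and> monotone_set (gph F \<inter> U \<times> V))"

text \<open>The neighborhood that witnesses maximality is one on which \<open>F\<close> is monotone. If the two
  neighborhoods were unrelated, the maximality clause would hold vacuously whenever \<open>F\<close> is
  not monotone on the larger one: no globally monotone \<open>S\<close> would extend it. Every locally but not
  globally monotone mapping (such as the one with graph \<open>{(0, 0), (1, -1)}\<close> on the real line)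
  would then be locally maximal monotone.\<close>

definition locally_maximal_monotone_at :: "('a::real_inner \<Rightarrow> 'a set) \<Rightarrow> 'a \<Rightarrow> 'a \<Rightarrow> bool" where
  "locally_maximal_monotone_at F xb yb \<longleftrightarrow>
     (\<exists>U V. xb \<in> interior U \<and> yb \<in> interior V \<and>
        monotone_set (gph F \<inter> U \<times> V) \<and>
        (\<forall>S. globally_monotone S \<and> gph F \<inter> U \<times> V \<subseteq> gph S \<longrightarrow>
              gph F \<inter> U \<times> V = gph S \<inter> U \<times> V))"

lemma locally_maximal_monotone_at_imp_locally_monotone_at:
  "locally_maximal_monotone_at F xb yb \<Longrightarrow> locally_monotone_at F xb yb"
  unfolding locally_maximal_monotone_at_def locally_monotone_at_def by blast

definition locally_maximal_hypomonotone_at :: "('a::real_inner \<Rightarrow> 'a set) \<Rightarrow> 'a \<Rightarrow> 'a \<Rightarrow> bool" where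
  "locally_maximal_hypomonotone_at F xb yb \<longleftrightarrow>
     (\<exists>\<rho>>0. locally_maximal_monotone_at (plus_scaled_id F \<rho>) xb (yb + \<rho> *\<^sub>R xb))"

definition graphical_derivative ::
    "('a::real_normed_vector \<Rightarrow> 'a set) \<Rightarrow> 'a \<Rightarrow> 'a \<Rightarrow> 'a \<Rightarrow> 'a set" where
  "graphical_derivative F x y u =
     {v. \<exists>s us vs. (\<forall>k::nat. s k > (0::real)) \<and> s \<longlonglongrightarrow> 0 \<and> us \<longlonglongrightarrow> u \<and> vs \<longlonglongrightarrow> v \<and>
           (\<forall>k. (x + s k *\<^sub>R us k, y + s k *\<^sub>R vs k) \<in> gph F)}"

definition derivative_lower_definite_around ::
    "real \<Rightarrow> ('a::real_inner \<Rightarrow> 'a set) \<Rightarrow> 'a \<Rightarrow> 'a \<Rightarrow> bool" where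
  "derivative_lower_definite_around \<kappa> F xb yb \<longleftrightarrow>
     (\<exists>A. (xb, yb) \<in> interior A \<and>
        (\<forall>(x, y) \<in> A \<inter> gph F. \<forall>u. \<forall>v \<in> graphical_derivative F x y u.
            inner u v \<ge> \<kappa> * (norm u)\<^sup>2))"

end

theory Submission
  imports Defs
begin

text \<open>
Passing from \<open>F\<close> to \<open>F + r Id\<close> applies the shear \<open>(x, y) \<mapsto> (x, y + r x)\<close> to the graph. The proof
shows that local maximal monotonicity at a point of the graph means that the graph coincides, near
that point, with a maximal monotone set \<open>T\<close> (\<open>locally_maximal_monotone_at_iff_agree_near\<close>), and then
reads both sides of the equivalence as statements about shears of \<open>T\<close>.

That a graph agreeing with \<open>T\<close> near the point is locally maximal is a property of arbitrary open balls
\<open>U\<close>, \<open>V\<close> around a point of \<open>T\<close>: a point of \<open>U \<times> V\<close> that is monotonically related to all points of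
\<open>T \<inter> U \<times> V\<close> lies in \<open>T\<close> (\<open>maximal_monotone_in_balls\<close>). The resolvents of \<open>T\<close>, which exist by Minty's
theorem, supply a point of \<open>T \<inter> U \<times> V\<close> to which the given point is monotonically related only if the
two are equal.

Resolvents also show that a shear of \<open>T\<close> which is merely monotone near a point coincides there with
some maximal monotone set (\<open>locally_monotone_shear_agrees_near_maximal\<close>): the resolvent is defined
on a whole neighborhood, and this leaves no room for an additional point. So the theorem reduces to
local monotonicity. From \<open>F - \<kappa> Id\<close> to \<open>F + \<rho> Id\<close> with \<open>\<rho> + \<kappa> > 0\<close>, monotonicity is only improved,
and the lower bound on \<open>DF\<close> is the limit of the monotonicity inequality.

In the other direction, local monotonicity of \<open>F - \<kappa> Id\<close> has to be recovered from the bound on \<open>DF\<close>.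
Let \<open>J\<close> be a resolvent of \<open>T\<close>. Two points of \<open>T\<close> that violate the inequality are the values at the ends
of a Lipschitz curve \<open>c(t) = J(z + t w)\<close>, and the violation says that the mean slope of \<open>c\<close> lies outside
a certain ball. In a Hilbert space such a curve has, at some \<open>t\<close> and along some sequence of step sizes
decreasing to zero, a strong derivative \<open>u\<close> that is still outside the ball
(\<open>lipschitz_curve_sequential_derivative\<close>). Since the curve runs through resolvent pairs, \<open>u\<close> gives an
element of the graphical derivative that violates the bound.
\<close>

section \<open>Monotone sets and maximal extensions\<close>

definition maximal_monotone :: "('a::real_inner \<times> 'a) set \<Rightarrow> bool" where
  "maximal_monotone T \<longleftrightarrow>
     monotone_set T \<and> (\<forall>M. monotone_set M \<and> T \<subseteq> M \<longrightarrow> M = T)"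

lemma monotone_setD:
  "monotone_set M \<Longrightarrow> (x, y) \<in> M \<Longrightarrow> (x', y') \<in> M \<Longrightarrow> inner (y - y') (x - x') \<ge> 0"
  unfolding monotone_set_def by fast

lemma monotone_setI:
  "(\<And>x y x' y'. (x, y) \<in> M \<Longrightarrow> (x', y') \<in> M \<Longrightarrow> inner (y - y') (x - x') \<ge> 0) \<Longrightarrow> monotone_set M"
  unfolding monotone_set_def by fast

lemma monotone_set_subset: "monotone_set M \<Longrightarrow> N \<subseteq> M \<Longrightarrow> monotone_set N"
  unfolding monotone_set_def by blast

lemma monotone_set_insert:
  assumes "monotone_set M" and "\<And>a b. (a, b) \<in> M \<Longrightarrow> inner (y - b) (x - a) \<ge> 0"
  shows "monotone_set (insert (x, y) M)"
proof (rule monotone_setI)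
  fix p q p' q' assume "(p, q) \<in> insert (x, y) M" "(p', q') \<in> insert (x, y) M"
  moreover have "inner (b - y) (a - x) \<ge> 0" if "(a, b) \<in> M" for a b
    using assms(2)[OF that] by (simp add: inner_diff_left inner_diff_right)
  ultimately show "inner (q - q') (p - p') \<ge> 0"
    using assms monotone_setD[OF assms(1)] by auto
qed

lemma maximal_monotone_mem:
  assumes "maximal_monotone T" and "\<And>a b. (a, b) \<in> T \<Longrightarrow> inner (y - b) (x - a) \<ge> 0"
  shows "(x, y) \<in> T"
  using monotone_set_insert[of T y x] assms unfolding maximal_monotone_def by blast

lemma monotone_set_extends_to_maximal:
  assumes "monotone_set M"
  obtains T where "M \<subseteq> T" "maximal_monotone T"
proof -
  have "\<exists>U\<in>{N. monotone_set N \<and> M \<subseteq> N}. \<forall>X\<in>C. X \<subseteq> U"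
    if C: "subset.chain {N. monotone_set N \<and> M \<subseteq> N} C" for C
  proof (cases "C = {}")
    case True
    then show ?thesis using assms by auto
  next
    case False
    have "monotone_set (\<Union>C)"
    proof (rule monotone_setI)
      fix x y x' y' assume "(x, y) \<in> \<Union>C" "(x', y') \<in> \<Union>C"
      then obtain N N' where N: "N \<in> C" "N' \<in> C" "(x, y) \<in> N" "(x', y') \<in> N'" by blast
      with C have "N \<subseteq> N' \<or> N' \<subseteq> N" "monotone_set N" "monotone_set N'"
        unfolding subset_chain_def by auto
      with N show "inner (y - y') (x - x') \<ge> 0"
        by (meson monotone_setD subsetD)
    qed
    moreover have "M \<subseteq> \<Union>C" using False C unfolding subset_chain_def by fast
    ultimately show ?thesis by blast
  qed
  from subset_Zorn[OF this] obtain T where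
    T: "T \<in> {N. monotone_set N \<and> M \<subseteq> N}"
       "\<forall>X\<in>{N. monotone_set N \<and> M \<subseteq> N}. T \<subseteq> X \<longrightarrow> X = T"
    by blast
  then have "maximal_monotone T" unfolding maximal_monotone_def by (auto dest: order_trans)
  then show ?thesis using T that by blast
qed


section \<open>Minty's theorem\<close>

text \<open>Monotonicity of \<open>M\<close> says that two lifted points \<open>(a, b, \<langle>a, b\<rangle>)\<close> satisfy
  \<open>\<langle>a, b'\<rangle> + \<langle>a', b\<rangle> \<le> c + c'\<close>. For a fixed first point this is a half-space in the second one, so the
  inequality extends to the convex hull, first in one argument and then in the other; on the diagonal
  it is the claim.\<close>
lemma convex_combination_inner_le:
  assumes M: "monotone_set M"
    and k: "(a, b, c) \<in> convex hull ((\<lambda>(a, b). (a, b, inner a b)) ` M)" (is "_ \<in> convex hull ?K")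
  shows "inner a b \<le> c"
proof -
  define H where "H p = {q. inner (fst p) (fst (snd q)) + inner (fst (snd p)) (fst q)
                    \<le> snd (snd p) + snd (snd q)}" for p :: "'a \<times> 'a \<times> real"
  have convexH: "convex (H p)" for p
  proof (rule convexI)
    fix q r :: "'a \<times> 'a \<times> real" and u v :: real
    assume q: "q \<in> H p" and r: "r \<in> H p" and uv: "0 \<le> u" "0 \<le> v" "u + v = 1"
    have "u * (inner (fst p) (fst (snd q)) + inner (fst (snd p)) (fst q))
        + v * (inner (fst p) (fst (snd r)) + inner (fst (snd p)) (fst r))
        \<le> u * (snd (snd p) + snd (snd q)) + v * (snd (snd p) + snd (snd r))"
      using q r uv(1,2) unfolding H_def by (intro add_mono[of "u * _"] mult_left_mono) simp_all
    also have "\<dots> = (u + v) * snd (snd p) + (u * snd (snd q) + v * snd (snd r))"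
      by (simp add: algebra_simps)
    finally show "u *\<^sub>R q + v *\<^sub>R r \<in> H p"
      using uv(3) by (simp add: H_def inner_add_right algebra_simps)
  qed
  have "q \<in> H p" if pq: "p \<in> ?K" "q \<in> ?K" for p q
  proof -
    obtain s t s' t' where "(s, t) \<in> M" "p = (s, t, inner s t)"
      "(s', t') \<in> M" "q = (s', t', inner s' t')" using pq by auto
    with monotone_setD[OF M, of s t s' t'] show ?thesis
      by (simp add: H_def inner_diff_left inner_diff_right inner_commute)
  qed
  then have "?K \<subseteq> H p" if "p \<in> ?K" for p using that by blast
  then have "convex hull ?K \<subseteq> H p" if "p \<in> ?K" for p
    using that by (intro hull_minimal convexH)
  then have "?K \<subseteq> H (a, b, c)"
    using k unfolding H_def by (fastforce simp: inner_commute add.commute)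
  then have "convex hull ?K \<subseteq> H (a, b, c)" by (intro hull_minimal convexH)
  with k show ?thesis by (auto simp: H_def inner_commute)
qed

lemma norm_convex_combination:
  fixes x y :: "'a::real_inner"
  shows "(norm ((1 - t) *\<^sub>R x + t *\<^sub>R y))\<^sup>2
    = (1 - t) * (norm x)\<^sup>2 + t * (norm y)\<^sup>2 - t * (1 - t) * (norm (x - y))\<^sup>2"
  by (simp add: power2_norm_eq_inner inner_add_left inner_add_right inner_diff_left
      inner_diff_right inner_commute algebra_simps)

text \<open>The existence part of Minty's theorem for the point \<open>0\<close>. The functions
  \<open>\<phi>(x) = \<langle>x + b, x - a\<rangle>\<close>, one for each \<open>(a, b) \<in> M\<close>, have a common point where they are nonpositive.
  Each is \<open>g + \<parallel>x - X\<parallel>\<^sup>2\<close> with minimizer \<open>X = (a - b)/2\<close> and minimum \<open>g = - \<langle>a, b\<rangle> - \<parallel>X\<parallel>\<^sup>2\<close>. The concave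
  function \<open>g\<close> on the convex hull of the lifted points is the dual problem of minimizing the supremum of
  all \<open>\<phi>\<close>. It is nonpositive, and it is strongly concave in \<open>X\<close>, so a maximizing sequence has
  convergent \<open>X\<close>, even if no maximizer exists. Moving a little towards a point of \<open>M\<close> cannot
  raise \<open>g\<close> above its supremum, and this bounds \<open>\<phi>\<close> at the limit. Completeness thus replaces weak
  compactness and minimax theorems.\<close>
lemma monotone_related_point_on_antidiagonal:
  fixes M :: "('a::{real_inner, complete_space} \<times> 'a) set"
  assumes M: "monotone_set M"
  shows "\<exists>x. \<forall>(a, b)\<in>M. inner (- x - b) (x - a) \<ge> 0"
proof (cases "M = {}")
  case True
  then show ?thesis by simp
next
  case False
  define K where "K = convex hull ((\<lambda>(a, b). (a, b, inner a b)) ` M)"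
  define X where "X k = (1/2) *\<^sub>R (fst k - fst (snd k))" for k :: "'a \<times> 'a \<times> real"
  define g where "g k = - snd (snd k) - (norm (X k))\<^sup>2" for k
  have comb: "g ((1 - t) *\<^sub>R k + t *\<^sub>R l) = (1 - t) * g k + t * g l + t * (1 - t) * (norm (X k - X l))\<^sup>2"
    for k l t
  proof -
    have X_lin: "X ((1 - t) *\<^sub>R k + t *\<^sub>R l) = (1 - t) *\<^sub>R X k + t *\<^sub>R X l"
      by (simp add: X_def diff_divide_distrib algebra_simps)
    then show ?thesis
      unfolding g_def X_lin norm_convex_combination by (simp add: algebra_simps)
  qed
  have Kconv: "(1 - t) *\<^sub>R k + t *\<^sub>R l \<in> K" if "k \<in> K" "l \<in> K" "0 \<le> t" "t \<le> 1" for k l t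
    using that unfolding K_def by (intro convexD[OF convex_convex_hull]) auto
  have g_nonpos: "g k \<le> 0" if "k \<in> K" for k
  proof -
    obtain a b c where k: "k = (a, b, c)" by (cases k)
    have "inner a b \<le> c" using convex_combination_inner_le[OF M] that unfolding K_def k by blast
    moreover have "inner a b + (norm (X k))\<^sup>2 = (norm ((1/2) *\<^sub>R (a + b)))\<^sup>2"
      by (simp add: k X_def power2_norm_eq_inner inner_add_left inner_add_right
          inner_diff_left inner_diff_right inner_commute field_simps)
    moreover have "(norm ((1/2) *\<^sub>R (a + b)))\<^sup>2 \<ge> 0" by (rule zero_le_power2)
    ultimately have "- c \<le> (norm (X k))\<^sup>2" by linarith
    then show ?thesis by (simp add: g_def k)
  qed
  have Kne: "K \<noteq> {}" using False by (simp add: K_def)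
  define S where "S = Sup (g ` K)"
  have bdd: "bdd_above (g ` K)" using g_nonpos by (intro bdd_aboveI2)
  have gS: "g k \<le> S" if "k \<in> K" for k
    unfolding S_def using that bdd by (intro cSup_upper) auto
  have S0: "S \<le> 0" unfolding S_def using Kne g_nonpos by (intro cSup_least) auto
  have "\<exists>k\<in>K. S - inverse (real (Suc n)) < g k" for n
    using less_cSup_iff[of "g ` K" "S - inverse (real (Suc n))"] Kne bdd
    unfolding S_def by auto
  then obtain k where k: "\<And>n. k n \<in> K" "\<And>n. S - inverse (real (Suc n)) < g (k n)"
    by metis
  have gk: "(\<lambda>n. g (k n)) \<longlonglongrightarrow> S"
  proof (rule real_tendsto_sandwich)
    show "(\<lambda>n. S - inverse (real (Suc n))) \<longlonglongrightarrow> S"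
      using tendsto_diff[OF tendsto_const LIMSEQ_inverse_real_of_nat, of S] by simp
    show "(\<lambda>n. S) \<longlonglongrightarrow> S" by simp
    show "\<forall>\<^sub>F n in sequentially. S - inverse (real (Suc n)) \<le> g (k n)"
      using less_imp_le[OF k(2)] by (rule always_eventually[OF allI])
    show "\<forall>\<^sub>F n in sequentially. g (k n) \<le> S"
      using gS[OF k(1)] by (rule always_eventually[OF allI])
  qed
  have "Cauchy (\<lambda>n. X (k n))"
  proof (rule CauchyI)
    fix e :: real assume e: "e > 0"
    have "\<forall>\<^sub>F n in sequentially. S - e\<^sup>2 / 4 < g (k n)"
      using e by (intro order_tendstoD(1)[OF gk]) simp
    then obtain N where N: "\<And>n. n \<ge> N \<Longrightarrow> S - e\<^sup>2 / 4 < g (k n)"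
      unfolding eventually_sequentially by blast
    have "norm (X (k m) - X (k n)) < e" if "m \<ge> N" "n \<ge> N" for m n
    proof -
      have "g ((1 - 1/2) *\<^sub>R k m + (1/2) *\<^sub>R k n) \<le> S" using k(1) by (intro gS Kconv) auto
      then have "(norm (X (k m) - X (k n)))\<^sup>2 < e\<^sup>2"
        using N[OF that(1)] N[OF that(2)] unfolding comb by (simp add: field_simps)
      then show ?thesis using e by (simp add: power2_less_imp_less)
    qed
    then show "\<exists>N. \<forall>m\<ge>N. \<forall>n\<ge>N. norm (X (k m) - X (k n)) < e" by blast
  qed
  then obtain x where x: "(\<lambda>n. X (k n)) \<longlonglongrightarrow> x"
    using Cauchy_convergent_iff convergent_def by blast
  have "inner (- x - b) (x - a) \<ge> 0" if ab: "(a, b) \<in> M" for a b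
  proof -
    define l where "l = (a, b, inner a b)"
    have lK: "l \<in> K" unfolding K_def l_def using ab by (intro hull_inc) force
    have le: "g l + (1 - t) * (norm (x - X l))\<^sup>2 \<le> S" if t: "0 < t" "t < 1" for t
    proof -
      have "(\<lambda>n. (1 - t) * g (k n) + t * g l + t * (1 - t) * (norm (X (k n) - X l))\<^sup>2)
          \<longlonglongrightarrow> (1 - t) * S + t * g l + t * (1 - t) * (norm (x - X l))\<^sup>2"
        by (intro tendsto_intros gk x)
      moreover have "(1 - t) * g (k n) + t * g l + t * (1 - t) * (norm (X (k n) - X l))\<^sup>2 \<le> S" for n
        unfolding comb[symmetric] using t k(1) lK by (intro gS Kconv) auto
      ultimately have "(1 - t) * S + t * g l + t * (1 - t) * (norm (x - X l))\<^sup>2 \<le> S"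
        by (intro LIMSEQ_le_const2) auto
      then have "t * (g l + (1 - t) * (norm (x - X l))\<^sup>2) \<le> t * S" by (simp add: algebra_simps)
      then show ?thesis using t by simp
    qed
    have "((\<lambda>t. g l + (1 - t) * (norm (x - X l))\<^sup>2) \<longlongrightarrow> g l + (1 - 0) * (norm (x - X l))\<^sup>2)
        (at_right 0)"
      by (intro tendsto_intros)
    moreover have "\<forall>\<^sub>F t in at_right (0::real). g l + (1 - t) * (norm (x - X l))\<^sup>2 \<le> S"
      unfolding eventually_at_right_field using le by (intro exI[of _ 1]) auto
    ultimately have "g l + (norm (x - X l))\<^sup>2 \<le> S"
      using tendsto_upperbound[of _ _ "at_right (0::real)" S] by force
    moreover have "inner (x + b) (x - a) = g l + (norm (x - X l))\<^sup>2"
      by (simp add: g_def X_def l_def power2_norm_eq_inner inner_add_left inner_add_right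
          inner_diff_left inner_diff_right inner_commute field_simps)
    ultimately have "inner (x + b) (x - a) \<le> 0" using S0 by simp
    then show ?thesis by (simp add: inner_diff_left inner_add_left)
  qed
  then show ?thesis by blast
qed

text \<open>The points \<open>(x, z - \<sigma> x)\<close> become \<open>(x, - x)\<close> after the affine change \<open>y \<mapsto> (y - z)/\<sigma>\<close> of the second
  coordinate, which preserves monotonicity; maximality turns a related point into a point of \<open>T\<close>.\<close>
lemma Minty:
  fixes T :: "('a::{real_inner, complete_space} \<times> 'a) set"
  assumes T: "maximal_monotone T" and "\<sigma> > 0"
  shows "\<exists>x. (x, z - \<sigma> *\<^sub>R x) \<in> T"
proof -
  define M where "M = (\<lambda>(a, b). (a, (1/\<sigma>) *\<^sub>R (b - z))) ` T"
  have "monotone_set M"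
  proof (rule monotone_setI)
    fix x y x' y' assume "(x, y) \<in> M" "(x', y') \<in> M"
    then obtain b b' where b: "(x, b) \<in> T" "y = (1/\<sigma>) *\<^sub>R (b - z)"
      "(x', b') \<in> T" "y' = (1/\<sigma>) *\<^sub>R (b' - z)" unfolding M_def by auto
    have "y - y' = (1/\<sigma>) *\<^sub>R (b - b')" by (simp add: b algebra_simps)
    then show "inner (y - y') (x - x') \<ge> 0"
      using monotone_setD[OF _ b(1) b(3)] T \<open>\<sigma> > 0\<close> by (simp add: maximal_monotone_def)
  qed
  then obtain x where x: "\<forall>(a, b)\<in>M. inner (- x - b) (x - a) \<ge> 0"
    using monotone_related_point_on_antidiagonal by blast
  have "inner (z - \<sigma> *\<^sub>R x - b) (x - a) \<ge> 0" if "(a, b) \<in> T" for a b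
  proof -
    have "inner (- x - (1/\<sigma>) *\<^sub>R (b - z)) (x - a) \<ge> 0"
      using x that unfolding M_def by fastforce
    then have "\<sigma> * inner (- x - (1/\<sigma>) *\<^sub>R (b - z)) (x - a) \<ge> 0" using \<open>\<sigma> > 0\<close> by simp
    also have "\<sigma> * inner (- x - (1/\<sigma>) *\<^sub>R (b - z)) (x - a)
        = inner (\<sigma> *\<^sub>R (- x - (1/\<sigma>) *\<^sub>R (b - z))) (x - a)" by simp
    also have "\<sigma> *\<^sub>R (- x - (1/\<sigma>) *\<^sub>R (b - z)) = z - \<sigma> *\<^sub>R x - b"
      using \<open>\<sigma> > 0\<close> by (simp add: algebra_simps)
    finally show ?thesis .
  qed
  then show ?thesis using maximal_monotone_mem[OF T] by blast
qed

section \<open>Resolvents\<close>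

definition resolvent :: "('a::real_vector \<times> 'a) set \<Rightarrow> real \<Rightarrow> 'a \<Rightarrow> 'a" where
  "resolvent T \<sigma> z = (SOME x. (x, z - \<sigma> *\<^sub>R x) \<in> T)"

lemma resolvent_mem:
  fixes T :: "('a::{real_inner, complete_space} \<times> 'a) set"
  assumes "maximal_monotone T" and "\<sigma> > 0"
  shows "(resolvent T \<sigma> z, z - \<sigma> *\<^sub>R resolvent T \<sigma> z) \<in> T"
  unfolding resolvent_def using Minty[OF assms] by (rule someI_ex)

text \<open>Strong monotonicity of \<open>T + \<sigma> Id\<close>, in the form that makes resolvents single-valued and Lipschitz.\<close>
lemma monotone_set_norm_diff_le:
  assumes "monotone_set T" and "(x, y) \<in> T" and "(x', y') \<in> T"
  shows "\<sigma> * norm (x - x') \<le> norm ((y + \<sigma> *\<^sub>R x) - (y' + \<sigma> *\<^sub>R x'))"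
proof (cases "x = x'")
  case False
  have "\<sigma> * norm (x - x') * norm (x - x') \<le> inner (y - y') (x - x') + \<sigma> * (norm (x - x'))\<^sup>2"
    using monotone_setD[OF assms] by (simp add: power2_eq_square)
  also have "\<dots> = inner ((y + \<sigma> *\<^sub>R x) - (y' + \<sigma> *\<^sub>R x')) (x - x')"
    by (simp add: power2_norm_eq_inner inner_add_left inner_diff_left inner_diff_right algebra_simps)
  also have "\<dots> \<le> norm ((y + \<sigma> *\<^sub>R x) - (y' + \<sigma> *\<^sub>R x')) * norm (x - x')"
    by (rule norm_cauchy_schwarz)
  finally show ?thesis using False by simp
qed simp

lemma resolvent_eq:
  fixes T :: "('a::{real_inner, complete_space} \<times> 'a) set"
  assumes T: "maximal_monotone T" and s: "\<sigma> > 0" and xy: "(x, y) \<in> T"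
  shows "resolvent T \<sigma> (y + \<sigma> *\<^sub>R x) = x"
  using monotone_set_norm_diff_le[OF _ resolvent_mem[OF T s, of "y + \<sigma> *\<^sub>R x"] xy, of \<sigma>] T s
  by (simp add: maximal_monotone_def mult_le_0_iff)

lemma resolvent_lipschitz:
  fixes T :: "('a::{real_inner, complete_space} \<times> 'a) set"
  assumes T: "maximal_monotone T" and s: "\<sigma> > 0"
  shows "(1 / \<sigma>)-lipschitz_on UNIV (resolvent T \<sigma>)"
proof (rule lipschitz_onI)
  fix z w :: 'a
  show "dist (resolvent T \<sigma> z) (resolvent T \<sigma> w) \<le> 1 / \<sigma> * dist z w"
    using monotone_set_norm_diff_le[OF _ resolvent_mem[OF T s, of z] resolvent_mem[OF T s, of w], of \<sigma>] T s
    by (simp add: maximal_monotone_def dist_norm field_simps)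
qed (use s in simp)

text \<open>Continuity in the parameter, for a fixed argument, allows a resolvent of prescribed norm to be
  chosen by the intermediate value theorem.\<close>
lemma continuous_resolvent_parameter:
  fixes T :: "('a::{real_inner, complete_space} \<times> 'a) set"
  assumes T: "maximal_monotone T" and \<theta>: "\<theta> > 0"
  shows "isCont (\<lambda>\<theta>. resolvent T \<theta> z) \<theta>"
proof -
  define J where "J s = resolvent T s z" for s
  have "norm (J s - J \<theta>) \<le> \<bar>s - \<theta>\<bar> * norm (J \<theta>) / s" if s: "s > 0" for s
  proof -
    have "s * norm (J s - J \<theta>) \<le> norm ((z - s *\<^sub>R J s + s *\<^sub>R J s) - (z - \<theta> *\<^sub>R J \<theta> + s *\<^sub>R J \<theta>))"
      using T s \<theta> unfolding J_def maximal_monotone_def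
      by (intro monotone_set_norm_diff_le[of T] resolvent_mem[OF T]) auto
    also have "\<dots> = norm ((\<theta> - s) *\<^sub>R J \<theta>)"
      by (simp add: norm_minus_commute scaleR_diff_left)
    also have "\<dots> = \<bar>s - \<theta>\<bar> * norm (J \<theta>)" by (simp add: abs_minus_commute)
    finally show ?thesis using s by (simp add: pos_le_divide_eq mult.commute)
  qed
  moreover have "\<forall>\<^sub>F s in at \<theta>. s > 0"
    using \<theta> by (intro order_tendstoD(1)[OF tendsto_ident_at])
  ultimately have "\<forall>\<^sub>F s in at \<theta>. norm (J s - J \<theta>) \<le> \<bar>s - \<theta>\<bar> * norm (J \<theta>) / s"
    by (auto elim: eventually_mono)
  moreover have "((\<lambda>s. \<bar>s - \<theta>\<bar> * norm (J \<theta>) / s) \<longlongrightarrow> \<bar>\<theta> - \<theta>\<bar> * norm (J \<theta>) / \<theta>) (at \<theta>)"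
    using \<theta> by (intro tendsto_intros) auto
  then have "((\<lambda>s. \<bar>s - \<theta>\<bar> * norm (J \<theta>) / s) \<longlongrightarrow> 0) (at \<theta>)" by simp
  ultimately have "((\<lambda>s. J s - J \<theta>) \<longlongrightarrow> 0) (at \<theta>)"
    by (rule Lim_null_comparison)
  then have "(J \<longlongrightarrow> J \<theta>) (at \<theta>)" by (rule LIM_zero_cancel)
  then show ?thesis unfolding isCont_def J_def .
qed


section \<open>Maximal monotone sets in products of balls\<close>

text \<open>Let \<open>r\<close> be between \<open>\<parallel>x\<parallel>\<close> and \<open>\<delta>\<close>, and let \<open>z = y + \<sigma> x\<close>. A point \<open>(a, b) \<in> T\<close> with
  \<open>b + \<theta> a = z\<close> and \<open>\<theta> > 0\<close> satisfies \<open>\<parallel>b\<parallel> \<le> \<parallel>z\<parallel>\<close> because \<open>(0, 0) \<in> T\<close>. So \<open>\<sigma>\<close> is taken small enough for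
  \<open>\<parallel>z\<parallel> < \<epsilon>\<close>, and the second constraint never matters. The first one is met by raising \<open>\<theta>\<close> above \<open>\<sigma>\<close>
  until \<open>\<parallel>a\<parallel> \<le> r\<close>, which adds to the equation a term \<open>(\<theta> - \<sigma>) a\<close> that is a normal vector of the ball of
  radius \<open>r\<close>. Since \<open>x\<close> is inside that ball, the extra term only helps in
  \<open>\<langle>x - a, y - b\<rangle> \<le> - \<sigma> \<parallel>x - a\<parallel>\<^sup>2\<close>, and the relation to \<open>(a, b)\<close> forces \<open>(x, y) = (a, b)\<close>.\<close>
lemma maximal_monotone_in_balls_origin:
  fixes T :: "('a::{real_inner, complete_space} \<times> 'a) set"
  assumes T: "maximal_monotone T" and zero: "(0, 0) \<in> T"
    and x: "norm x < \<delta>" and y: "norm y < \<epsilon>"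
    and rel: "\<And>a b. (a, b) \<in> T \<Longrightarrow> norm a < \<delta> \<Longrightarrow> norm b < \<epsilon> \<Longrightarrow> inner (y - b) (x - a) \<ge> 0"
  shows "(x, y) \<in> T"
proof -
  have mono: "monotone_set T" using T by (simp add: maximal_monotone_def)
  obtain r where r: "norm x < r" "r < \<delta>" using x dense by blast
  have r0: "r > 0" using r(1) norm_ge_zero[of x] by linarith
  define \<sigma> where "\<sigma> = (\<epsilon> - norm y) / (2 * r)"
  have \<sigma>: "\<sigma> > 0" using y r0 by (simp add: \<sigma>_def)
  define z where "z = y + \<sigma> *\<^sub>R x"
  have "norm z \<le> norm y + \<sigma> * norm x"
    unfolding z_def using \<sigma> norm_triangle_ineq[of y "\<sigma> *\<^sub>R x"] by simp
  also have "\<sigma> * norm x \<le> \<sigma> * r" using \<sigma> r by simp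
  also have "norm y + \<sigma> * r < \<epsilon>" using r0 y by (simp add: \<sigma>_def field_simps)
  finally have z: "norm z < \<epsilon>" by simp
  define J where "J \<theta> = resolvent T \<theta> z" for \<theta>
  have J: "(J \<theta>, z - \<theta> *\<^sub>R J \<theta>) \<in> T" if "\<theta> > 0" for \<theta>
    unfolding J_def by (rule resolvent_mem[OF T that])
  have pos: "inner (z - \<theta> *\<^sub>R J \<theta>) (J \<theta>) \<ge> 0" if "\<theta> > 0" for \<theta>
    using monotone_setD[OF mono J[OF that] zero] by simp
  have b: "norm (z - \<theta> *\<^sub>R J \<theta>) < \<epsilon>" if \<theta>: "\<theta> > 0" for \<theta>
  proof -
    let ?b = "z - \<theta> *\<^sub>R J \<theta>"
    have "norm ?b * norm ?b \<le> inner ?b ?b + \<theta> * inner ?b (J \<theta>)"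
      using pos[OF \<theta>] \<theta> by (simp add: power2_norm_eq_inner flip: power2_eq_square)
    also have "\<dots> = inner ?b z" by (simp add: inner_diff_right)
    also have "\<dots> \<le> norm ?b * norm z" by (rule norm_cauchy_schwarz)
    finally have "norm ?b \<le> norm z" by (cases "?b = 0") auto
    with z show ?thesis by simp
  qed
  obtain \<theta> where \<theta>: "\<theta> \<ge> \<sigma>" "norm (J \<theta>) \<le> r" "\<theta> = \<sigma> \<or> norm (J \<theta>) = r"
  proof (cases "norm (J \<sigma>) \<le> r")
    case True
    then show ?thesis using that by blast
  next
    case False
    define \<Theta> where "\<Theta> = max \<sigma> (norm z / r)"
    have \<Theta>: "\<sigma> \<le> \<Theta>" "norm z / r \<le> \<Theta>" by (simp_all add: \<Theta>_def)
    have "\<Theta> * norm (J \<Theta>) \<le> norm z"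
      using monotone_set_norm_diff_le[OF mono J zero, of \<Theta> \<Theta>] \<Theta> \<sigma> by simp
    also have "\<dots> \<le> \<Theta> * r" using \<Theta>(2) r0 by (simp add: field_simps)
    finally have "norm (J \<Theta>) \<le> r" using \<Theta> \<sigma> by simp
    then have "\<exists>\<theta>\<ge>\<sigma>. \<theta> \<le> \<Theta> \<and> norm (J \<theta>) = r"
      using False \<Theta> \<sigma> unfolding J_def
      by (intro IVT2 allI impI isCont_norm continuous_resolvent_parameter[OF T]) auto
    then show ?thesis using that by auto
  qed
  have \<theta>0: "\<theta> > 0" using \<theta> \<sigma> by simp
  define a where "a = J \<theta>"
  \<comment> \<open>The last summand makes the inner product with \<open>x - a\<close> negative; the first is the normal vector.\<close>
  have yb: "y - (z - \<theta> *\<^sub>R a) = (\<theta> - \<sigma>) *\<^sub>R a - \<sigma> *\<^sub>R (x - a)"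
    by (simp add: z_def algebra_simps)
  have "0 \<le> inner (y - (z - \<theta> *\<^sub>R a)) (x - a)"
    using rel[OF J[OF \<theta>0] _ b[OF \<theta>0]] \<theta> r unfolding a_def by simp
  also have "\<dots> = (\<theta> - \<sigma>) * inner a (x - a) - \<sigma> * (norm (x - a))\<^sup>2"
    unfolding yb by (simp add: inner_diff_left power2_norm_eq_inner)
  finally have ineq: "\<sigma> * (norm (x - a))\<^sup>2 \<le> (\<theta> - \<sigma>) * inner a (x - a)" by simp
  have "\<theta> = \<sigma>"
  proof (rule ccontr)
    assume "\<theta> \<noteq> \<sigma>"
    then have \<theta>': "\<theta> > \<sigma>" "norm a = r" using \<theta> by (auto simp: a_def)
    have "inner a (x - a) = inner a x - r * r"
      using \<theta>'(2) by (simp add: inner_diff_right power2_eq_square flip: power2_norm_eq_inner)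
    also have "inner a x \<le> r * norm x" using norm_cauchy_schwarz[of a x] \<theta>' by simp
    also have "r * norm x < r * r" using r r0 by simp
    finally have "(\<theta> - \<sigma>) * inner a (x - a) < 0" using \<theta>' by (simp add: mult_pos_neg)
    with ineq \<sigma> show False
      by (meson less_le_trans not_less mult_nonneg_nonneg less_imp_le zero_le_power2)
  qed
  with ineq \<sigma> have "x = a" by (simp add: mult_le_0_iff)
  with yb \<open>\<theta> = \<sigma>\<close> have "y = z - \<theta> *\<^sub>R a" by simp
  with J[OF \<theta>0] \<open>x = a\<close> show ?thesis by (simp add: a_def)
qed

section \<open>Shears and agreement near a point\<close>

text \<open>The effect on graphs of adding \<open>r Id\<close>.\<close>
definition shear :: "real \<Rightarrow> 'a::real_vector \<times> 'a \<Rightarrow> 'a \<times> 'a" where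
  "shear r = (\<lambda>(x, y). (x, y + r *\<^sub>R x))"

lemma shear_image_iff: "(x, y) \<in> shear r ` A \<longleftrightarrow> (x, y - r *\<^sub>R x) \<in> A"
  by (force simp: shear_def image_iff split: prod.splits)

lemma shear_shear_image: "shear r ` shear s ` A = shear (r + s) ` A"
  by (simp add: image_image shear_def case_prod_beta scaleR_add_left add_ac)

lemma mem_plus_scaled_id_iff: "y \<in> plus_scaled_id F r x \<longleftrightarrow> y - r *\<^sub>R x \<in> F x"
  unfolding plus_scaled_id_def by (auto intro: exI[of _ "y - r *\<^sub>R x"])

lemma gph_plus_scaled_id: "gph (plus_scaled_id F r) = shear r ` gph F"
  by (intro set_eqI) (auto simp: gph_def mem_plus_scaled_id_iff shear_image_iff split_paired_all)

lemma continuous_on_shear: "continuous_on A (shear r)" for A :: "('a::real_normed_vector \<times> 'a) set"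
  unfolding shear_def case_prod_beta by (intro continuous_intros)

lemma monotone_set_shear_iff:
  "monotone_set (shear r ` M) \<longleftrightarrow>
    (\<forall>(x, y)\<in>M. \<forall>(x', y')\<in>M. inner (y - y') (x - x') + r * (norm (x - x'))\<^sup>2 \<ge> 0)"
proof -
  have "inner ((y + r *\<^sub>R x) - (y' + r *\<^sub>R x')) (x - x')
      = inner (y - y') (x - x') + r * (norm (x - x'))\<^sup>2" for x y x' y' :: 'a
    by (simp add: power2_norm_eq_inner inner_add_left inner_diff_left inner_diff_right algebra_simps)
  then show ?thesis unfolding monotone_set_def by (simp add: shear_def case_prod_beta)
qed

definition agree_near :: "'a::topological_space \<Rightarrow> 'a set \<Rightarrow> 'a set \<Rightarrow> bool" where
  "agree_near p A B \<longleftrightarrow> (\<exists>W. open W \<and> p \<in> W \<and> A \<inter> W = B \<inter> W)"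

lemma agree_near_trans:
  assumes "agree_near p A B" and "agree_near p B C"
  shows "agree_near p A C"
proof -
  obtain W W' where "open W" "p \<in> W" "A \<inter> W = B \<inter> W" "open W'" "p \<in> W'" "B \<inter> W' = C \<inter> W'"
    using assms unfolding agree_near_def by blast
  then show ?thesis unfolding agree_near_def by (intro exI[of _ "W \<inter> W'"]) auto
qed

lemma agree_near_shear:
  fixes A B :: "('a::real_normed_vector \<times> 'a) set"
  assumes "agree_near (x, y) A B"
  shows "agree_near (x, y + r *\<^sub>R x) (shear r ` A) (shear r ` B)"
proof -
  obtain W where W: "open W" "(x, y) \<in> W" "A \<inter> W = B \<inter> W"
    using assms unfolding agree_near_def by blast
  have "open (shear (- r) -` W)"
    using W(1) by (rule open_vimage) (rule continuous_on_shear)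
  moreover have "(x, y + r *\<^sub>R x) \<in> shear (- r) -` W" using W(2) by (simp add: shear_def)
  moreover have "shear r ` A \<inter> shear (- r) -` W = shear r ` B \<inter> shear (- r) -` W"
    using W(3) by (auto simp: shear_image_iff shear_def)
  ultimately show ?thesis unfolding agree_near_def by blast
qed

section \<open>Local maximality as agreement with a maximal monotone set\<close>

text \<open>Maximal monotonicity is invariant under translations, so the point \<open>(xb, yb)\<close> may be moved to the
  origin.\<close>
lemma maximal_monotone_in_balls:
  fixes T :: "('a::{real_inner, complete_space} \<times> 'a) set"
  assumes T: "maximal_monotone T" and p: "(xb, yb) \<in> T"
    and x: "x \<in> ball xb \<delta>" and y: "y \<in> ball yb \<epsilon>"
    and rel: "\<And>a b. (a, b) \<in> T \<inter> ball xb \<delta> \<times> ball yb \<epsilon> \<Longrightarrow> inner (y - b) (x - a) \<ge> 0"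
  shows "(x, y) \<in> T"
proof -
  define T' where "T' = {(a, b). (a + xb, b + yb) \<in> T}"
  have T'_iff: "(a, b) \<in> T' \<longleftrightarrow> (a + xb, b + yb) \<in> T" for a b by (simp add: T'_def)
  have max': "maximal_monotone T'"
    unfolding maximal_monotone_def
  proof (intro conjI allI impI)
    show "monotone_set T'"
    proof (rule monotone_setI)
      fix a b a' b' assume "(a, b) \<in> T'" "(a', b') \<in> T'"
      with T monotone_setD[of T "a + xb" "b + yb" "a' + xb" "b' + yb"]
      show "inner (b - b') (a - a') \<ge> 0" by (simp add: T'_iff maximal_monotone_def)
    qed
    fix M assume M: "monotone_set M \<and> T' \<subseteq> M"
    have "(a, b) \<in> T'" if ab: "(a, b) \<in> M" for a b
      unfolding T'_iff
    proof (rule maximal_monotone_mem[OF T])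
      fix c d assume "(c, d) \<in> T"
      then have "(c - xb, d - yb) \<in> M" using M T'_iff[of "c - xb" "d - yb"] by auto
      with monotone_setD[of M, OF _ ab, of "c - xb" "d - yb"] M
      show "inner (b + yb - d) (a + xb - c) \<ge> 0" by (simp add: algebra_simps)
    qed
    with M show "M = T'" by auto
  qed
  have "(x - xb, y - yb) \<in> T'"
  proof (rule maximal_monotone_in_balls_origin[OF max', of _ \<delta> _ \<epsilon>])
    fix a b assume ab: "(a, b) \<in> T'" "norm a < \<delta>" "norm b < \<epsilon>"
    then have "inner (y - (b + yb)) (x - (a + xb)) \<ge> 0"
      by (intro rel) (auto simp: T'_iff dist_norm)
    then show "inner (y - yb - b) (x - xb - a) \<ge> 0" by (simp add: algebra_simps)
  qed (use p x y in \<open>auto simp: T'_iff dist_norm norm_minus_commute\<close>)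
  then show ?thesis by (simp add: T'_iff)
qed

lemma open_contains_ball_product:
  fixes x :: "'a::metric_space" and y :: "'b::metric_space"
  assumes "open W" and "(x, y) \<in> W"
  obtains r where "r > 0" "ball x r \<times> ball y r \<subseteq> W"
proof -
  obtain A B where AB: "open A" "open B" "(x, y) \<in> A \<times> B" "A \<times> B \<subseteq> W"
    using open_prod_elim[OF assms] by blast
  obtain d where "d > 0" "ball x d \<subseteq> A" using openE[OF AB(1), of x] AB(3) by blast
  moreover obtain e where "e > 0" "ball y e \<subseteq> B" using openE[OF AB(2), of y] AB(3) by blast
  ultimately show ?thesis using AB(4) by (intro that[of "min d e"]) (auto 0 4 simp: subset_iff)
qed

text \<open>From left to right, any maximal extension of the local graph will do. From right to left,
  \<open>maximal_monotone_in_balls\<close> makes every sufficiently small pair of balls a witness.\<close>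
lemma locally_maximal_monotone_at_iff_agree_near:
  fixes F :: "'a::{real_inner, complete_space} \<Rightarrow> 'a set"
  assumes p: "(xb, yb) \<in> gph F"
  shows "locally_maximal_monotone_at F xb yb \<longleftrightarrow>
    (\<exists>T. maximal_monotone T \<and> agree_near (xb, yb) (gph F) T)"
proof
  assume "locally_maximal_monotone_at F xb yb"
  then obtain U V where UV: "xb \<in> interior U" "yb \<in> interior V" "monotone_set (gph F \<inter> U \<times> V)"
    "\<And>S. globally_monotone S \<Longrightarrow> gph F \<inter> U \<times> V \<subseteq> gph S \<Longrightarrow> gph F \<inter> U \<times> V = gph S \<inter> U \<times> V"
    unfolding locally_maximal_monotone_at_def by blast
  obtain T where T: "gph F \<inter> U \<times> V \<subseteq> T" "maximal_monotone T"
    using monotone_set_extends_to_maximal[OF UV(3)] by blast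
  have gph_T: "gph (\<lambda>x. {y. (x, y) \<in> T}) = T" by (auto simp: gph_def)
  have "globally_monotone (\<lambda>x. {y. (x, y) \<in> T})"
    using T(2) unfolding globally_monotone_def gph_T maximal_monotone_def by blast
  from UV(4)[OF this] T(1) have "gph F \<inter> U \<times> V = T \<inter> U \<times> V" by (simp add: gph_T)
  then have "gph F \<inter> interior U \<times> interior V = T \<inter> interior U \<times> interior V"
    using interior_subset[of U] interior_subset[of V] by blast
  then have "agree_near (xb, yb) (gph F) T"
    unfolding agree_near_def using UV(1,2)
    by (intro exI[of _ "interior U \<times> interior V"]) (auto simp: open_Times)
  with T(2) show "\<exists>T. maximal_monotone T \<and> agree_near (xb, yb) (gph F) T" by blast
next
  assume "\<exists>T. maximal_monotone T \<and> agree_near (xb, yb) (gph F) T"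
  then obtain T W where T: "maximal_monotone T" and W: "open W" "(xb, yb) \<in> W" "gph F \<inter> W = T \<inter> W"
    unfolding agree_near_def by blast
  obtain r where r: "r > 0" "ball xb r \<times> ball yb r \<subseteq> W"
    using open_contains_ball_product[OF W(1,2)] .
  define R where "R = ball xb r \<times> ball yb r"
  have eq: "gph F \<inter> R = T \<inter> R" using r(2) W(3) unfolding R_def by blast
  have "gph F \<inter> R = gph S \<inter> R" if S: "globally_monotone S" "gph F \<inter> R \<subseteq> gph S" for S
  proof -
    have "(x, y) \<in> T" if xy: "(x, y) \<in> gph S \<inter> R" for x y
    proof (rule maximal_monotone_in_balls[OF T, of xb yb _ r _ r])
      show "(xb, yb) \<in> T" using p W(2,3) by blast
      fix a b assume "(a, b) \<in> T \<inter> ball xb r \<times> ball yb r"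
      then have "(a, b) \<in> gph S" using S(2) eq unfolding R_def by blast
      with S(1) xy show "inner (y - b) (x - a) \<ge> 0"
        unfolding globally_monotone_def by (blast intro: monotone_setD)
    qed (use xy in \<open>auto simp: R_def\<close>)
    with S(2) eq show ?thesis by fast
  qed
  moreover have "monotone_set (gph F \<inter> R)"
    unfolding eq using T by (auto simp: maximal_monotone_def intro: monotone_set_subset)
  ultimately show "locally_maximal_monotone_at F xb yb"
    unfolding locally_maximal_monotone_at_def R_def using r(1)
    by (intro exI[of _ "ball xb r"] exI[of _ "ball yb r"]) (auto simp: interior_open)
qed

section \<open>Local maximality under shears\<close>

lemma open_resolvent_preimage:
  fixes T :: "('a::{real_inner, complete_space} \<times> 'a) set"
  assumes "maximal_monotone T" and "\<sigma> > 0" and "open W"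
  shows "open ((\<lambda>z. (resolvent T \<sigma> z, z - \<sigma> *\<^sub>R resolvent T \<sigma> z)) -` W)"
  using assms lipschitz_on_continuous_on[OF resolvent_lipschitz[OF assms(1,2)]]
  by (intro open_vimage continuous_intros) auto

text \<open>Let \<open>T'\<close> be a maximal extension of the sheared local part of \<open>T\<close>, and let \<open>\<sigma> > max 0 r\<close>. The point
  \<open>(x, y)\<close> of \<open>T'\<close> and the sheared resolvent pair of \<open>T\<close> at \<open>z = y + (\<sigma> - r) x\<close> have the same value of
  \<open>y + (\<sigma> - r) x\<close>. Near the base point the latter is also in \<open>T'\<close>, so strong monotonicity of
  \<open>T' + (\<sigma> - r) Id\<close> identifies the two, and \<open>T'\<close> contains nothing else there.\<close>
lemma locally_monotone_shear_agrees_near_maximal: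
  fixes T :: "('a::{real_inner, complete_space} \<times> 'a) set"
  assumes T: "maximal_monotone T" and p: "(xb, yb) \<in> T"
    and W: "open W" "(xb, yb) \<in> W" and mono: "monotone_set (shear r ` (T \<inter> W))"
  obtains T' where "maximal_monotone T'" "agree_near (xb, yb + r *\<^sub>R xb) (shear r ` T) T'"
proof -
  obtain T' where T': "shear r ` (T \<inter> W) \<subseteq> T'" "maximal_monotone T'"
    using monotone_set_extends_to_maximal[OF mono] by blast
  define \<sigma> where "\<sigma> = \<bar>r\<bar> + 1"
  have \<sigma>: "\<sigma> > 0" "\<sigma> - r > 0" by (auto simp: \<sigma>_def)
  define z where "z q = snd q + (\<sigma> - r) *\<^sub>R fst q" for q :: "'a \<times> 'a"
  define g where "g z = (resolvent T \<sigma> z, z - \<sigma> *\<^sub>R resolvent T \<sigma> z)" for z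
  define N where "N = z -` (g -` W) \<inter> shear (- r) -` W"
  have "open (z -` (g -` W))"
    unfolding g_def
    by (intro open_vimage[OF open_resolvent_preimage[OF T \<sigma>(1) W(1)]])
      (auto simp: z_def intro!: continuous_intros)
  then have "open N" unfolding N_def
    by (intro open_Int open_vimage[OF W(1)] continuous_on_shear)
  moreover have "(xb, yb + r *\<^sub>R xb) \<in> N"
  proof -
    have "z (xb, yb + r *\<^sub>R xb) = yb + \<sigma> *\<^sub>R xb" by (simp add: z_def algebra_simps)
    then have "g (z (xb, yb + r *\<^sub>R xb)) = (xb, yb)"
      using resolvent_eq[OF T \<sigma>(1) p] by (simp add: g_def)
    with W(2) show ?thesis by (simp add: N_def shear_def)
  qed
  moreover have "shear r ` T \<inter> N = T' \<inter> N"
  proof (intro set_eqI iffI)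
    fix q assume q: "q \<in> shear r ` T \<inter> N"
    then obtain m where m: "m \<in> T" "q = shear r m" by blast
    have "shear (- r) (shear r m) = m" by (simp add: shear_def case_prod_beta)
    then have "m \<in> W" using q m(2) by (simp add: N_def)
    with m q T'(1) show "q \<in> T' \<inter> N" by blast
  next
    fix q assume q: "q \<in> T' \<inter> N"
    obtain x y where xy: "q = (x, y)" by (cases q)
    define j where "j = resolvent T \<sigma> (z q)"
    have jT: "(j, z q - \<sigma> *\<^sub>R j) \<in> T" unfolding j_def by (rule resolvent_mem[OF T \<sigma>(1)])
    have "(j, z q - \<sigma> *\<^sub>R j) \<in> W" using q by (simp add: N_def g_def j_def)
    with jT T'(1) have "(j, z q - \<sigma> *\<^sub>R j + r *\<^sub>R j) \<in> T'" by (force simp: shear_def)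
    then have "(\<sigma> - r) * norm (x - j)
        \<le> norm ((y + (\<sigma> - r) *\<^sub>R x) - ((z q - \<sigma> *\<^sub>R j + r *\<^sub>R j) + (\<sigma> - r) *\<^sub>R j))"
      using q T'(2) unfolding xy maximal_monotone_def by (intro monotone_set_norm_diff_le) auto
    also have "\<dots> = 0" by (simp add: xy z_def algebra_simps)
    finally have "x = j" using \<sigma>(2) by (simp add: mult_le_0_iff)
    then have "y - r *\<^sub>R x = z q - \<sigma> *\<^sub>R j" by (simp add: xy z_def algebra_simps)
    with jT \<open>x = j\<close> q show "q \<in> shear r ` T \<inter> N" by (simp add: xy shear_image_iff)
  qed
  ultimately show ?thesis using that T'(2) unfolding agree_near_def by blast
qed

section \<open>Derivatives of Lipschitz curves\<close>

definition slope :: "(real \<Rightarrow> 'a::real_vector) \<Rightarrow> real \<Rightarrow> real \<Rightarrow> 'a" where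
  "slope c s t = (1 / (t - s)) *\<^sub>R (c t - c s)"

lemma norm_slope_le:
  fixes c :: "real \<Rightarrow> 'a::real_normed_vector"
  assumes "L-lipschitz_on A c" and "s \<in> A" "t \<in> A" "s < t"
  shows "norm (slope c s t) \<le> L"
proof -
  have "norm (c t - c s) \<le> L * (t - s)"
    using lipschitz_onD[OF assms(1) assms(3) assms(2)] assms(4) by (simp add: dist_norm)
  then show ?thesis using assms(4) by (simp add: slope_def pos_divide_le_eq)
qed

text \<open>Suppose that the slope \<open>q\<close> over \<open>[s, t]\<close> is almost as far from \<open>p\<close> as any slope over a subinterval.
  Then some \<open>\<tau>\<close> is the left end only of slopes close to \<open>q\<close>. Project the curve to the direction \<open>q - p\<close> and
  subtract a linear function that grows a little slower than the projected mean. At a minimum \<open>\<tau>\<close> of the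
  difference, all slopes to the right have almost the largest possible component in that direction;
  as they stay within distance \<open>N\<close> of \<open>p\<close>, they are near \<open>q\<close>.\<close>
lemma flat_left_endpoint:
  fixes c :: "real \<Rightarrow> 'a::real_inner"
  assumes cont: "continuous_on {s..t} c" and st: "s < t" and \<delta>: "\<delta> > 0"
    and far: "\<And>x y. s \<le> x \<Longrightarrow> x < y \<Longrightarrow> y \<le> t \<Longrightarrow> norm (slope c x y - p) \<le> N"
    and near: "N\<^sup>2 \<le> (norm (slope c s t - p))\<^sup>2 + \<delta>"
  obtains \<tau> where "s \<le> \<tau>" "\<tau> < t"
    "\<And>x. \<tau> < x \<Longrightarrow> x \<le> t \<Longrightarrow> (norm (slope c \<tau> x - slope c s t))\<^sup>2 \<le> 3 * \<delta>"
proof -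
  define q where "q = slope c s t"
  define e where "e = q - p"
  define h where "h = (inner p e + (norm e)\<^sup>2 - \<delta>)"
  define g where "g x = inner (c x) e - h * x" for x
  have g_slope: "g y - g x = (y - x) * (inner (slope c x y - p) e - (norm e)\<^sup>2 + \<delta>)" if "x < y" for x y
  proof -
    have "c y - c x = (y - x) *\<^sub>R slope c x y" using that by (simp add: slope_def)
    then have "inner (c y) e - inner (c x) e = (y - x) * inner (slope c x y) e"
      by (metis inner_diff_left inner_scaleR_left)
    then show ?thesis by (simp add: g_def h_def inner_diff_left algebra_simps)
  qed
  have "continuous_on {s..t} g" unfolding g_def by (intro continuous_intros cont)
  then obtain \<tau> where \<tau>: "\<tau> \<in> {s..t}" "\<And>x. x \<in> {s..t} \<Longrightarrow> g \<tau> \<le> g x"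
    using continuous_attains_inf[of "{s..t}" g] st by auto
  have "g t - g s = (t - s) * \<delta>"
    unfolding g_slope[OF st] q_def[symmetric] e_def[symmetric] by (simp add: power2_norm_eq_inner)
  moreover have "(t - s) * \<delta> > 0" using st \<delta> by simp
  ultimately have "g s < g t" by linarith
  with \<tau>(2)[of s] \<tau>(1) st have "\<tau> < t" by (cases "\<tau> = t") auto
  moreover have "(norm (slope c \<tau> x - q))\<^sup>2 \<le> 3 * \<delta>" if x: "\<tau> < x" "x \<le> t" for x
  proof -
    let ?r = "slope c \<tau> x"
    have "0 \<le> (x - \<tau>) * (inner (?r - p) e - (norm e)\<^sup>2 + \<delta>)"
      unfolding g_slope[OF x(1), symmetric] using \<tau> x by simp
    then have 1: "(norm e)\<^sup>2 - \<delta> \<le> inner (?r - p) e" using x by (simp add: zero_le_mult_iff)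
    have "(norm (?r - p))\<^sup>2 \<le> N\<^sup>2" using far[of \<tau> x] \<tau>(1) x by (intro power_mono) auto
    then have 2: "(norm (?r - p))\<^sup>2 \<le> (norm e)\<^sup>2 + \<delta>" using near by (simp add: e_def q_def)
    have eq: "?r - q = (?r - p) - e" by (simp add: e_def)
    have "(norm (?r - q))\<^sup>2 = (norm (?r - p))\<^sup>2 - 2 * inner (?r - p) e + (norm e)\<^sup>2"
      unfolding eq by (simp add: power2_norm_eq_inner inner_diff_left inner_diff_right inner_commute algebra_simps)
    with 1 2 show ?thesis by simp
  qed
  ultimately show ?thesis using that \<tau>(1) unfolding q_def by auto
qed

text \<open>The supremum of the distances of slopes to \<open>p\<close> need not be attained, so intervals are only nearly
  optimal; they can still be chosen at least as good as the whole interval.\<close>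
lemma near_sup_slope:
  fixes c :: "real \<Rightarrow> 'a::real_normed_vector"
  assumes lip: "L-lipschitz_on {a..b} c" and ab: "a < b"
  obtains N where "N \<ge> 0" 
    "\<And>x y. a \<le> x \<Longrightarrow> x < y \<Longrightarrow> y \<le> b \<Longrightarrow> norm (slope c x y - p) \<le> N"
    "\<And>\<delta>. \<delta> > 0 \<Longrightarrow> \<exists>s t. a \<le> s \<and> s < t \<and> t \<le> b \<and>
       norm (slope c a b - p) \<le> norm (slope c s t - p) \<and> N\<^sup>2 \<le> (norm (slope c s t - p))\<^sup>2 + \<delta>"
proof -
  define D where "D = {norm (slope c x y - p) | x y. a \<le> x \<and> x < y \<and> y \<le> b}"
  define N where "N = Sup D"
  have bdd: "bdd_above D"
  proof (rule bdd_aboveI)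
    fix d assume "d \<in> D"
    then obtain x y where "d = norm (slope c x y - p)" "a \<le> x" "x < y" "y \<le> b"
      unfolding D_def by blast
    then show "d \<le> L + norm p"
      using norm_slope_le[OF lip, of x y] norm_triangle_ineq4[of "slope c x y" p] by simp
  qed
  have abD: "norm (slope c a b - p) \<in> D" using ab unfolding D_def by blast
  have up: "norm (slope c x y - p) \<le> N" if "a \<le> x" "x < y" "y \<le> b" for x y
    unfolding N_def using that bdd by (intro cSup_upper) (auto simp: D_def)
  have N0: "N \<ge> 0" using up[of a b] ab norm_ge_zero[of "slope c a b - p"] by linarith
  have "\<exists>s t. a \<le> s \<and> s < t \<and> t \<le> b \<and>
       norm (slope c a b - p) \<le> norm (slope c s t - p) \<and> N\<^sup>2 \<le> (norm (slope c s t - p))\<^sup>2 + \<delta>"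
    if \<delta>: "\<delta> > 0" for \<delta>
  proof -
    define \<eta> where "\<eta> = \<delta> / (2 * N + 1)"
    have \<eta>: "\<eta> > 0" "2 * N * \<eta> \<le> \<delta>"
      using \<delta> N0 by (simp_all add: \<eta>_def field_simps)
    obtain d where d: "d \<in> D" "N - \<eta> < d"
      using less_cSupD[of D "N - \<eta>"] abD \<eta>(1) unfolding N_def by auto
    define m where "m = max d (norm (slope c a b - p))"
    have "m \<in> D" using d(1) abD unfolding m_def max_def by simp
    then obtain s t where st: "a \<le> s" "s < t" "t \<le> b" "m = norm (slope c s t - p)"
      unfolding D_def by blast
    have m: "N - \<eta> < m" "norm (slope c a b - p) \<le> m" "m \<le> N"
      using d up[OF st(1-3)] by (auto simp: m_def st(4)[symmetric]) 
    have "N\<^sup>2 - m\<^sup>2 = (N - m) * (N + m)" by (simp add: power2_eq_square algebra_simps)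
    also have "\<dots> \<le> \<eta> * (2 * N)"
      using m \<eta> norm_ge_zero[of "slope c s t - p"] N0 unfolding st(4)[symmetric] by (intro mult_mono) auto
    finally have "N\<^sup>2 \<le> m\<^sup>2 + \<delta>" using \<eta>(2) by (simp add: mult_ac)
    with st m show ?thesis by auto
  qed
  with up N0 show ?thesis using that by blast
qed

text \<open>One step of the nested construction. It selects a slope \<open>q\<close> over \<open>[s, t]\<close> nearly farthest from \<open>p\<close>,
  and then a short interval \<open>[a', b']\<close> at the flat left endpoint. There, all slopes at one scale \<open>\<sigma>\<close> are
  near \<open>q\<close>, since \<open>c\<close> is Lipschitz and \<open>b' - a'\<close> is much smaller than \<open>\<sigma>\<close>.

  Slopes over other subintervals of \<open>[a', b']\<close> may have any direction, and a later step must not pick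
  these. This is prevented by the new center \<open>p' = 2 p - q\<close>, the reflection of \<open>q\<close> in \<open>p\<close>: all slopes lie
  in a ball around \<open>p\<close> that has \<open>q\<close> nearly on its boundary, and by the parallelogram law those points of
  the ball that are nearly farthest from \<open>p'\<close> are near \<open>q\<close>. The next step, applied to \<open>[a', b']\<close> and \<open>p'\<close>,
  picks a slope at least as far from \<open>p'\<close> as the one over \<open>[a', b']\<close>, hence a slope near \<open>q\<close>.\<close>
lemma slope_refinement_step:
  fixes c :: "real \<Rightarrow> 'a::real_inner"
  assumes lip: "L-lipschitz_on {a..b} c" and ab: "a < b" and \<epsilon>: "\<epsilon> > 0"
  obtains s t a' b' p' \<sigma> where
    "a \<le> s" "s < t" "t \<le> b" "norm (slope c a b - p) \<le> norm (slope c s t - p)"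
    "a \<le> a'" "a' < b'" "b' \<le> b" "0 < \<sigma>" "\<sigma> \<le> \<epsilon>"
    "\<And>\<tau>. a' \<le> \<tau> \<Longrightarrow> \<tau> \<le> b' \<Longrightarrow> \<tau> + \<sigma> \<le> b \<and> norm (slope c \<tau> (\<tau> + \<sigma>) - slope c s t) \<le> \<epsilon>"
    "\<And>x y. a' \<le> x \<Longrightarrow> x < y \<Longrightarrow> y \<le> b' \<Longrightarrow> norm (slope c a' b' - p') \<le> norm (slope c x y - p')
        \<Longrightarrow> norm (slope c x y - slope c s t) \<le> \<epsilon>"
proof -
  obtain N where N: "N \<ge> 0"
    "\<And>x y. a \<le> x \<Longrightarrow> x < y \<Longrightarrow> y \<le> b \<Longrightarrow> norm (slope c x y - p) \<le> N"
    "\<And>\<delta>. \<delta> > 0 \<Longrightarrow> \<exists>s t. a \<le> s \<and> s < t \<and> t \<le> b \<and>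
       norm (slope c a b - p) \<le> norm (slope c s t - p) \<and> N\<^sup>2 \<le> (norm (slope c s t - p))\<^sup>2 + \<delta>"
    using near_sup_slope[OF lip ab, of p] by blast
  \<comment> \<open>\<open>\<kappa>\<close> bounds the deviation of the slopes at the flat endpoint; the third entry of the minimum is
    what the parallelogram estimate at the end needs.\<close>
  define \<kappa> where "\<kappa> = Min {1, \<epsilon> / 2, \<epsilon>\<^sup>2 / (4 * N + 1)}"
  have \<kappa>: "\<kappa> > 0" "\<kappa> \<le> 1" "\<kappa> \<le> \<epsilon> / 2" "\<kappa> \<le> \<epsilon>\<^sup>2 / (4 * N + 1)"
  proof -
    show "\<kappa> > 0" using \<epsilon> N(1) by (simp add: \<kappa>_def divide_pos_pos)
  qed (unfold \<kappa>_def, (rule Min_le; simp)+)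
  have \<kappa>\<epsilon>: "4 * N * \<kappa> + \<kappa>\<^sup>2 \<le> \<epsilon>\<^sup>2"
  proof -
    have "\<kappa>\<^sup>2 \<le> \<kappa>" using \<kappa> by (simp add: power2_eq_square mult_left_le)
    moreover have "\<kappa> * (4 * N + 1) \<le> \<epsilon>\<^sup>2" using \<kappa>(4) N(1) by (simp add: pos_le_divide_eq)
    ultimately show ?thesis by (simp add: algebra_simps)
  qed
  have "\<kappa>\<^sup>2 / 3 > 0" using \<kappa>(1) by simp
  from N(3)[OF this] obtain s t where st: "a \<le> s" "s < t" "t \<le> b"
    "norm (slope c a b - p) \<le> norm (slope c s t - p)"
    "N\<^sup>2 \<le> (norm (slope c s t - p))\<^sup>2 + \<kappa>\<^sup>2 / 3" by blast
  define q where "q = slope c s t"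
  define \<rho> where "\<rho> = norm (q - p)"
  have \<rho>: "0 \<le> \<rho>" "\<rho> \<le> N" "N\<^sup>2 \<le> \<rho>\<^sup>2 + \<kappa>\<^sup>2 / 3"
    using N(2)[of s t] st by (auto simp: \<rho>_def q_def)
  have "continuous_on {s..t} c"
    by (rule continuous_on_subset[OF lipschitz_on_continuous_on[OF lip]]) (use st in auto)
  then obtain \<tau> where \<tau>: "s \<le> \<tau>" "\<tau> < t"
    "\<And>x. \<tau> < x \<Longrightarrow> x \<le> t \<Longrightarrow> (norm (slope c \<tau> x - q))\<^sup>2 \<le> \<kappa>\<^sup>2"
    using flat_left_endpoint[of s t c "\<kappa>\<^sup>2 / 3" p N] st N(2) \<kappa>(1) unfolding q_def by auto
  have flat: "norm (slope c \<tau> x - q) \<le> \<kappa>" if "\<tau> < x" "x \<le> t" for x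
    using \<kappa>(1) by (intro power2_le_imp_le[OF \<tau>(3)[OF that]]) simp
  define \<sigma> where "\<sigma> = min \<epsilon> ((t - \<tau>) / 2)"
  have "\<sigma> \<le> (t - \<tau>) / 2" unfolding \<sigma>_def by (rule min.cobounded2)
  then have \<sigma>: "\<sigma> > 0" "\<sigma> \<le> \<epsilon>" "\<tau> + 2 * \<sigma> \<le> t"
    using \<epsilon> \<tau>(2) by (simp_all add: \<sigma>_def)
  have L: "L \<ge> 0" using lipschitz_on_nonneg[OF lip] .
  define b' where "b' = \<tau> + min \<sigma> (\<epsilon> * \<sigma> / (4 * L + 1))"
  have b': "\<tau> < b'" "b' \<le> \<tau> + \<sigma>" "4 * L * (b' - \<tau>) \<le> \<epsilon> * \<sigma>"
  proof -
    have "4 * L * (b' - \<tau>) \<le> (4 * L + 1) * (\<epsilon> * \<sigma> / (4 * L + 1))"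
      using L \<sigma> \<epsilon> unfolding b'_def by (intro mult_mono) auto
    then show "4 * L * (b' - \<tau>) \<le> \<epsilon> * \<sigma>" using L by simp
  qed (use \<sigma> \<epsilon> L in \<open>auto simp: b'_def\<close>)
  define p' where "p' = 2 *\<^sub>R p - q"
  show ?thesis
  proof (rule that[of s t \<tau> b' \<sigma> p'])
    fix \<theta> assume \<theta>: "\<tau> \<le> \<theta>" "\<theta> \<le> b'"
    have "slope c \<theta> (\<theta> + \<sigma>) - slope c \<tau> (\<tau> + \<sigma>)
        = (1 / \<sigma>) *\<^sub>R ((c (\<theta> + \<sigma>) - c (\<tau> + \<sigma>)) - (c \<theta> - c \<tau>))"
      by (simp add: slope_def algebra_simps)
    also have "norm \<dots> \<le> (1 / \<sigma>) * (norm (c (\<theta> + \<sigma>) - c (\<tau> + \<sigma>)) + norm (c \<theta> - c \<tau>))"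
      using \<sigma>(1) by (simp add: divide_right_mono norm_triangle_ineq4)
    also have "\<dots> \<le> (1 / \<sigma>) * (L * (b' - \<tau>) + L * (b' - \<tau>))"
    proof (intro mult_left_mono add_mono)
      have "L * (\<theta> - \<tau>) \<le> L * (b' - \<tau>)" using L \<theta> by (intro mult_left_mono) auto
      then show "norm (c (\<theta> + \<sigma>) - c (\<tau> + \<sigma>)) \<le> L * (b' - \<tau>)" "norm (c \<theta> - c \<tau>) \<le> L * (b' - \<tau>)"
        using lipschitz_onD[OF lip, of "\<theta> + \<sigma>" "\<tau> + \<sigma>"] lipschitz_onD[OF lip, of \<theta> \<tau>] \<theta> \<tau>(1) \<sigma> st b'
        by (auto simp: dist_norm)
    qed (use \<sigma> in simp)
    also have "\<dots> \<le> \<epsilon> / 2"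
    proof -
      have "L * (b' - \<tau>) + L * (b' - \<tau>) \<le> \<epsilon> / 2 * \<sigma>" using b'(3) by simp
      then have "(L * (b' - \<tau>) + L * (b' - \<tau>)) / \<sigma> \<le> \<epsilon> / 2"
        by (subst pos_divide_le_eq[OF \<sigma>(1)])
      then show ?thesis by simp
    qed
    finally have "norm (slope c \<theta> (\<theta> + \<sigma>) - slope c \<tau> (\<tau> + \<sigma>)) \<le> \<epsilon> / 2" .
    moreover have "norm (slope c \<tau> (\<tau> + \<sigma>) - q) \<le> \<epsilon> / 2"
      using flat[of "\<tau> + \<sigma>"] \<sigma> \<kappa>(3) by simp
    ultimately have "norm (slope c \<theta> (\<theta> + \<sigma>) - q) \<le> \<epsilon>"
      using norm_triangle_ineq[of "slope c \<theta> (\<theta> + \<sigma>) - slope c \<tau> (\<tau> + \<sigma>)" "slope c \<tau> (\<tau> + \<sigma>) - q"]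
      by simp
    then show "\<theta> + \<sigma> \<le> b \<and> norm (slope c \<theta> (\<theta> + \<sigma>) - slope c s t) \<le> \<epsilon>"
      using \<theta> b' \<sigma> st unfolding q_def by simp
  next
    fix x y assume xy: "\<tau> \<le> x" "x < y" "y \<le> b'"
      and far: "norm (slope c \<tau> b' - p') \<le> norm (slope c x y - p')"
    let ?r = "slope c x y"
    have "q - p' = 2 *\<^sub>R (q - p)" by (simp add: p'_def scaleR_2 algebra_simps)
    then have "2 * \<rho> = norm (q - p')" by (simp add: \<rho>_def)
    also have "\<dots> \<le> norm (slope c \<tau> b' - p') + norm (slope c \<tau> b' - q)"
      using norm_triangle_ineq4[of "slope c \<tau> b' - p'" "slope c \<tau> b' - q"] by simp
    also have "\<dots> \<le> norm (?r - p') + \<kappa>" using far flat[of b'] b' \<sigma> by simp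
    finally have sum: "2 * \<rho> \<le> norm (?r - p') + \<kappa>" .
    have lower: "4 * \<rho>\<^sup>2 - 4 * \<rho> * \<kappa> \<le> (norm (?r - p'))\<^sup>2"
    proof (cases "2 * \<rho> \<le> \<kappa>")
      case True
      have "4 * \<rho>\<^sup>2 - 4 * \<rho> * \<kappa> = 4 * \<rho> * (\<rho> - \<kappa>)"
        by (simp add: power2_eq_square algebra_simps)
      also have "\<dots> \<le> 0" using True \<rho>(1) \<kappa>(1) by (intro mult_nonneg_nonpos) auto
      also have "0 \<le> (norm (?r - p'))\<^sup>2" by simp
      finally show ?thesis .
    next
      case False
      with sum have "(2 * \<rho> - \<kappa>)\<^sup>2 \<le> (norm (?r - p'))\<^sup>2" by (intro power_mono) auto
      moreover have "(2 * \<rho> - \<kappa>)\<^sup>2 = 4 * \<rho>\<^sup>2 - 4 * \<rho> * \<kappa> + \<kappa>\<^sup>2"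
        by (simp add: power2_eq_square algebra_simps)
      ultimately show ?thesis using zero_le_power2[of \<kappa>] by linarith
    qed
    have "(norm (?r - p))\<^sup>2 \<le> N\<^sup>2"
      using N(2)[of x y] xy \<tau>(1) b' \<sigma> st by (intro power_mono) auto
    moreover have "(norm (?r - q))\<^sup>2 + (norm (?r - p'))\<^sup>2 = 2 * (norm (?r - p))\<^sup>2 + 2 * \<rho>\<^sup>2"
      by (simp add: \<rho>_def p'_def power2_norm_eq_inner inner_add_left inner_add_right inner_diff_left
          inner_diff_right inner_commute algebra_simps)
    moreover have "4 * \<rho> * \<kappa> \<le> 4 * N * \<kappa>" using \<rho> \<kappa> by simp
    ultimately have sq: "(norm (?r - q))\<^sup>2 \<le> \<epsilon>\<^sup>2"
      using \<rho>(3) lower \<kappa>\<epsilon> zero_le_power2[of \<kappa>] by linarith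
    show "norm (slope c x y - slope c s t) \<le> \<epsilon>"
      using power2_le_imp_le[OF sq less_imp_le[OF \<epsilon>]] unfolding q_def .
  qed (use st \<tau>(1,2) b' \<sigma> in auto)
qed


text \<open>A substitute for almost everywhere differentiability of Lipschitz curves. Iterate the refinement
  step with tolerances \<open>\<epsilon>/2, \<epsilon>/4, \<dots>\<close>. Each selected slope is within the previous tolerance of the one
  before it, so the slopes converge to some \<open>u\<close>. The nested intervals shrink to a common point \<open>t\<close>,
  whose slope at the scale of each step is near the slope selected in that step.\<close>
lemma lipschitz_curve_sequential_derivative:
  fixes c :: "real \<Rightarrow> 'a::{real_inner, complete_space}"
  assumes lip: "L-lipschitz_on {a..b} c" and ab: "a < b" and \<epsilon>: "\<epsilon> > 0"
  obtains t u \<sigma> where "a \<le> t" "t < b" "\<forall>n. 0 < \<sigma> n \<and> t + \<sigma> n \<le> b" "\<sigma> \<longlonglongrightarrow> 0"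
    "(\<lambda>n. slope c t (t + \<sigma> n)) \<longlonglongrightarrow> u"
    "norm (slope c a b - p) \<le> norm (u - p) + \<epsilon>"
proof -
  define e where "e n = \<epsilon> / 2 ^ Suc n" for n
  have e0: "e n > 0" for n using \<epsilon> by (simp add: e_def)
  \<comment> \<open>A state consists of the current interval, the center, the slope selected last and its scale. The
    last clause of \<open>P\<close> confines the next selection.\<close>
  define P where "P n z = (case z of (s, t, p, q, \<sigma>) \<Rightarrow>
      a \<le> s \<and> s < t \<and> t \<le> b \<and> 0 < \<sigma> \<and> \<sigma> \<le> e n \<and>
      (\<forall>\<tau>. s \<le> \<tau> \<and> \<tau> \<le> t \<longrightarrow> \<tau> + \<sigma> \<le> b \<and> norm (slope c \<tau> (\<tau> + \<sigma>) - q) \<le> e n) \<and>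
      (\<forall>x y. s \<le> x \<and> x < y \<and> y \<le> t \<and> norm (slope c s t - p) \<le> norm (slope c x y - p)
         \<longrightarrow> norm (slope c x y - q) \<le> e n))"
    for n :: nat and z :: "real \<times> real \<times> 'a \<times> 'a \<times> real"
  define Q where "Q n z z' = (case z of (s, t, p, q, \<sigma>) \<Rightarrow> case z' of (s', t', p', q', \<sigma>') \<Rightarrow>
      s \<le> s' \<and> t' \<le> t \<and> norm (q' - q) \<le> e n)"
    for n :: nat and z z' :: "real \<times> real \<times> 'a \<times> 'a \<times> real"
  have "\<exists>z. P 0 z \<and> (case z of (s, t, p', q, \<sigma>) \<Rightarrow> norm (slope c a b - p) \<le> norm (q - p))"
  proof (rule slope_refinement_step[OF lip ab e0[of 0], of p], goal_cases)
    case (1 s t a' b' p' \<sigma>)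
    then have "P 0 (a', b', p', slope c s t, \<sigma>)" unfolding P_def by auto
    with 1(4) show ?case by (intro exI[of _ "(a', b', p', slope c s t, \<sigma>)"]) simp
  qed
  then obtain z0 where z0: "P 0 z0"
    "case z0 of (s, t, p', q, \<sigma>) \<Rightarrow> norm (slope c a b - p) \<le> norm (q - p)" by blast
  have step: "\<exists>z'. P (Suc n) z' \<and> Q n z z'" if Pz: "P n z" for n z
  proof -
    obtain s t r q \<sigma> where z: "z = (s, t, r, q, \<sigma>)" by (cases z)
    have st: "a \<le> s" "s < t" "t \<le> b"
      and slice: "\<And>x y. s \<le> x \<Longrightarrow> x < y \<Longrightarrow> y \<le> t \<Longrightarrow> norm (slope c s t - r) \<le> norm (slope c x y - r)
         \<Longrightarrow> norm (slope c x y - q) \<le> e n"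
      using Pz unfolding z P_def by auto
    have lip': "L-lipschitz_on {s..t} c" using lipschitz_on_subset[OF lip] st by auto
    show ?thesis
    proof (rule slope_refinement_step[OF lip' st(2) e0[of "Suc n"], of r], goal_cases)
      case (1 x y a' b' p' \<sigma>')
      have "P (Suc n) (a', b', p', slope c x y, \<sigma>')"
        using 1(5-9,11) st 1(10) unfolding P_def by fastforce
      moreover have "Q n z (a', b', p', slope c x y, \<sigma>')"
        using 1 slice unfolding Q_def z by auto
      ultimately show ?case by blast
    qed
  qed
  obtain z where z: "z 0 = z0" "\<And>n. P n (z n)" "\<And>n. Q n (z n) (z (Suc n))"
  proof -
    have "\<exists>z. \<forall>n. (P n (z n) \<and> (n = 0 \<longrightarrow> z n = z0)) \<and> Q n (z n) (z (Suc n))"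
      by (rule dependent_nat_choice[where P = "\<lambda>n w. P n w \<and> (n = 0 \<longrightarrow> w = z0)" and Q = Q])
        (use z0 step in auto)
    then show ?thesis using that by auto
  qed
  define s t q \<sigma> where "s n = fst (z n)" and "t n = fst (snd (z n))"
    and "q n = fst (snd (snd (snd (z n))))" and "\<sigma> n = snd (snd (snd (snd (z n))))" for n
  have st: "a \<le> s n" "s n < t n" "t n \<le> b" "0 < \<sigma> n" "\<sigma> n \<le> e n"
    and scale: "\<And>\<tau>. s n \<le> \<tau> \<Longrightarrow> \<tau> \<le> t n \<Longrightarrow> \<tau> + \<sigma> n \<le> b \<and> norm (slope c \<tau> (\<tau> + \<sigma> n) - q n) \<le> e n" for n
    using z(2)[of n] unfolding P_def s_def t_def q_def \<sigma>_def by (auto simp: case_prod_beta)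
  have next_le: "s n \<le> s (Suc n)" "t (Suc n) \<le> t n" "norm (q (Suc n) - q n) \<le> e n" for n
    using z(3)[of n] unfolding Q_def s_def t_def q_def by (auto simp: case_prod_beta)
  have start: "norm (slope c a b - p) \<le> norm (q 0 - p)"
    using z0(2) unfolding z(1)[symmetric] q_def by (auto simp: case_prod_beta)
  have s_mono: "incseq s" and t_mono: "decseq t"
    using next_le by (simp_all add: incseq_SucI decseq_SucI)
  have "s m \<le> t n" for m n
    using incseqD[OF s_mono, of m "max m n"] decseqD[OF t_mono, of n "max m n"] st(2)[of "max m n"]
    by linarith
  then have bdd: "bdd_above (range s)" by (intro bdd_aboveI2)
  define t' where "t' = (SUP n. s n)"
  have t': "s n \<le> t'" "t' \<le> t n" for n
    unfolding t'_def using \<open>\<And>m n. s m \<le> t n\<close> bdd by (auto intro: cSUP_upper cSUP_least)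
  have e_lim: "e \<longlonglongrightarrow> 0"
    unfolding e_def using LIMSEQ_divide_realpow_zero[of 2 "\<epsilon> / 2"] by simp
  have q_dist: "norm (q (n + k) - q n) \<le> 2 * e n - 2 * e (n + k)" for n k
  proof (induction k)
    case (Suc k)
    have "norm (q (n + Suc k) - q n) \<le> norm (q (Suc (n + k)) - q (n + k)) + norm (q (n + k) - q n)"
      using norm_triangle_ineq[of "q (Suc (n + k)) - q (n + k)" "q (n + k) - q n"] by simp
    also have "\<dots> \<le> e (n + k) + (2 * e n - 2 * e (n + k))"
      using next_le(3) Suc by (rule add_mono)
    also have "\<dots> = 2 * e n - 2 * e (n + Suc k)" by (simp add: e_def)
    finally show ?case .
  qed simp
  have q_le: "norm (q (n + k) - q n) \<le> 2 * e n" for n k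
    using q_dist[of n k] e0[of "n + k"] by linarith
  have "Cauchy q"
  proof (rule CauchyI')
    fix d :: real assume "d > 0"
    then have "\<forall>\<^sub>F n in sequentially. e n < d / 2" by (intro order_tendstoD(2)[OF e_lim]) simp
    then obtain M where M: "\<And>n. n \<ge> M \<Longrightarrow> e n < d / 2" unfolding eventually_sequentially by blast
    have "dist (q m) (q n) < d" if "m \<ge> M" "n > m" for m n
      using q_le[of m "n - m"] M[OF that(1)] that by (simp add: dist_norm norm_minus_commute)
    then show "\<exists>M. \<forall>m\<ge>M. \<forall>n>m. dist (q m) (q n) < d" by blast
  qed
  then obtain u where u: "q \<longlonglongrightarrow> u"
    using Cauchy_convergent_iff convergent_def by blast
  have slope_lim: "(\<lambda>n. slope c t' (t' + \<sigma> n)) \<longlonglongrightarrow> u"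
  proof -
    have "(\<lambda>n. slope c t' (t' + \<sigma> n) - q n) \<longlonglongrightarrow> 0"
      using scale[OF t'] by (intro Lim_null_comparison[OF _ e_lim] always_eventually) blast
    from tendsto_add[OF this u] show ?thesis by simp
  qed
  have "norm (q n - q 0) \<le> \<epsilon>" for n using q_le[of 0 n] by (simp add: e_def)
  then have "norm (u - q 0) \<le> \<epsilon>"
    by (intro LIMSEQ_le_const2[OF tendsto_norm[OF tendsto_diff[OF u tendsto_const]]]) auto
  then have "norm (slope c a b - p) \<le> norm (u - p) + \<epsilon>"
    using start norm_triangle_ineq[of "u - p" "q 0 - u"] by (simp add: norm_minus_commute)
  moreover have "\<sigma> \<longlonglongrightarrow> 0"
    using st(4,5) by (intro tendsto_sandwich[OF _ _ tendsto_const e_lim] always_eventually)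
      (auto intro: less_imp_le)
  moreover have "t' < b" using scale[OF t', of 0] st(4)[of 0] by linarith
  moreover have "a \<le> t'" using st(1)[of 0] t'(1)[of 0] by linarith
  moreover have "\<forall>n. 0 < \<sigma> n \<and> t' + \<sigma> n \<le> b" using st(4) scale[OF t'] by blast
  ultimately show ?thesis using that[of t' \<sigma> u] slope_lim by blast
qed

section \<open>From lower definite derivatives to local monotonicity\<close>

text \<open>A curve of resolvent pairs over the segment \<open>z + t w\<close> stays in the graph, so its derivative along a
  sequence of step sizes is a tangent vector of the graph.\<close>
lemma sequential_derivative_of_resolvent_curve:
  fixes F :: "'a::{real_inner, complete_space} \<Rightarrow> 'a set"
  assumes c: "\<And>s. 0 \<le> s \<Longrightarrow> s \<le> 1 \<Longrightarrow> (c s, z + s *\<^sub>R w - \<sigma> *\<^sub>R c s) \<in> gph F"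
    and t0: "0 \<le> t" and ts: "\<forall>n. 0 < s n \<and> t + s n \<le> 1" and s: "s \<longlonglongrightarrow> 0"
    and u: "(\<lambda>n. slope c t (t + s n)) \<longlonglongrightarrow> u"
  shows "w - \<sigma> *\<^sub>R u \<in> graphical_derivative F (c t) (z + t *\<^sub>R w - \<sigma> *\<^sub>R c t) u"
proof -
  have t: "0 \<le> t" "0 < s n" "t + s n \<le> 1" for n using t0 ts by auto
  define us where "us n = slope c t (t + s n)" for n
  have "(c t + s n *\<^sub>R us n, z + t *\<^sub>R w - \<sigma> *\<^sub>R c t + s n *\<^sub>R (w - \<sigma> *\<^sub>R us n)) \<in> gph F" for n
  proof -
    have "s n \<noteq> 0" using t(2)[of n] by simp
    then have su: "s n *\<^sub>R us n = c (t + s n) - c t" by (simp add: us_def slope_def)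
    have "s n *\<^sub>R (w - \<sigma> *\<^sub>R us n) = s n *\<^sub>R w - \<sigma> *\<^sub>R (s n *\<^sub>R us n)"
      by (simp add: algebra_simps)
    then have eq: "z + t *\<^sub>R w - \<sigma> *\<^sub>R c t + s n *\<^sub>R (w - \<sigma> *\<^sub>R us n)
        = z + (t + s n) *\<^sub>R w - \<sigma> *\<^sub>R c (t + s n)"
      unfolding su by (simp add: algebra_simps)
    have "(c (t + s n), z + (t + s n) *\<^sub>R w - \<sigma> *\<^sub>R c (t + s n)) \<in> gph F"
      using t(1) less_imp_le[OF t(2)[of n]] t(3)[of n] by (intro c) auto
    moreover have "c t + s n *\<^sub>R us n = c (t + s n)" unfolding su by simp
    ultimately show ?thesis unfolding eq by simp
  qed
  moreover have "(\<lambda>n. w - \<sigma> *\<^sub>R us n) \<longlonglongrightarrow> w - \<sigma> *\<^sub>R u"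
    using u unfolding us_def by (intro tendsto_intros)
  ultimately show ?thesis
    unfolding graphical_derivative_def using t(2) s u[folded us_def] by blast
qed

text \<open>Take \<open>\<sigma> > 0\<close> with \<open>\<sigma> + \<mu> > 0\<close> and the resolvent \<open>J\<close> of \<open>T\<close> with parameter \<open>\<sigma>\<close>. For two points of \<open>T\<close>
  with difference \<open>(q, w - \<sigma> q)\<close>, the inequality to be shown is \<open>\<langle>q, w\<rangle> \<ge> (\<sigma> + \<mu>) \<parallel>q\<parallel>\<^sup>2\<close>, which says that
  \<open>q\<close> lies in the closed ball with center \<open>p = w / (2 (\<sigma> + \<mu>))\<close> and radius \<open>\<parallel>p\<parallel>\<close>. If it fails, then the mean
  slope \<open>q\<close> of the curve \<open>J(z + t w)\<close> is outside this ball, hence so is some sequential derivative \<open>u\<close>, and the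
  tangent vector \<open>(u, w - \<sigma> u)\<close> of the graph violates the assumed bound.\<close>
lemma lower_definite_derivative_imp_locally_monotone_shear:
  fixes T :: "('a::{real_inner, complete_space} \<times> 'a) set"
  assumes T: "maximal_monotone T" and p: "(xb, yb) \<in> T"
    and agree: "agree_near (xb, yb) (gph F) T"
    and lower: "derivative_lower_definite_around \<mu> F xb yb"
  obtains W where "open W" "(xb, yb) \<in> W" "monotone_set (shear (- \<mu>) ` (T \<inter> W))"
proof -
  obtain A where A: "(xb, yb) \<in> interior A"
    "\<And>x y u v. (x, y) \<in> A \<inter> gph F \<Longrightarrow> v \<in> graphical_derivative F x y u \<Longrightarrow> inner u v \<ge> \<mu> * (norm u)\<^sup>2"
    using lower unfolding derivative_lower_definite_around_def by blast
  obtain B where B: "open B" "(xb, yb) \<in> B" "gph F \<inter> B = T \<inter> B"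
    using agree unfolding agree_near_def by blast
  define \<sigma> where "\<sigma> = \<bar>\<mu>\<bar> + 1"
  have \<sigma>: "\<sigma> > 0" "\<sigma> + \<mu> > 0" by (auto simp: \<sigma>_def)
  define J where "J = resolvent T \<sigma>"
  define g where "g z = (J z, z - \<sigma> *\<^sub>R J z)" for z
  have J_eq: "J (y + \<sigma> *\<^sub>R x) = x" if "(x, y) \<in> T" for x y
    unfolding J_def by (rule resolvent_eq[OF T \<sigma>(1) that])
  have "open (g -` (interior A \<inter> B))"
    unfolding g_def J_def using B(1) by (intro open_resolvent_preimage[OF T \<sigma>(1)]) auto
  moreover have "yb + \<sigma> *\<^sub>R xb \<in> g -` (interior A \<inter> B)"
    using A(1) B(2) J_eq[OF p] by (simp add: g_def)
  ultimately obtain r where r: "r > 0" "ball (yb + \<sigma> *\<^sub>R xb) r \<subseteq> g -` (interior A \<inter> B)"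
    unfolding open_contains_ball by blast
  have g_ball: "g z \<in> A \<inter> gph F" "g z \<in> gph F" if "z \<in> ball (yb + \<sigma> *\<^sub>R xb) r" for z
  proof -
    have "g z \<in> T" unfolding g_def J_def by (rule resolvent_mem[OF T \<sigma>(1)])
    moreover have "g z \<in> interior A \<inter> B" using r(2) that by blast
    ultimately show "g z \<in> A \<inter> gph F" "g z \<in> gph F" using B(3) interior_subset[of A] by blast+
  qed
  define W where "W = (\<lambda>q. snd q + \<sigma> *\<^sub>R fst q) -` ball (yb + \<sigma> *\<^sub>R xb) r"
  have "open W" unfolding W_def by (intro open_vimage open_ball continuous_intros)
  moreover have "(xb, yb) \<in> W" using r(1) by (simp add: W_def)
  moreover have "inner (y - y') (x - x') + (- \<mu>) * (norm (x - x'))\<^sup>2 \<ge> 0"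
    if xy: "(x, y) \<in> T \<inter> W" and xy': "(x', y') \<in> T \<inter> W" for x y x' y'
  proof (rule ccontr)
    define z where "z = y' + \<sigma> *\<^sub>R x'"
    define w where "w = y + \<sigma> *\<^sub>R x - z"
    define p where "p = (1 / (2 * (\<sigma> + \<mu>))) *\<^sub>R w"
    have farther_iff: "norm p < norm (q - p) \<longleftrightarrow> inner q w < (\<sigma> + \<mu>) * (norm q)\<^sup>2" for q
    proof -
      have "2 * inner q p = inner q w / (\<sigma> + \<mu>)" using \<sigma>(2) by (simp add: p_def field_simps)
      moreover have "(norm (q - p))\<^sup>2 - (norm p)\<^sup>2 = (norm q)\<^sup>2 - 2 * inner q p"
        by (simp add: power2_norm_eq_inner inner_diff_left inner_diff_right inner_commute)
      moreover have "\<not> norm (q - p) \<le> norm p \<longleftrightarrow> \<not> (norm (q - p))\<^sup>2 \<le> (norm p)\<^sup>2" by simp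
      moreover have "inner q w / (\<sigma> + \<mu>) < (norm q)\<^sup>2 \<longleftrightarrow> inner q w < (\<sigma> + \<mu>) * (norm q)\<^sup>2"
        using \<sigma>(2) by (simp add: pos_divide_less_eq mult.commute)
      ultimately show ?thesis unfolding not_le by linarith
    qed
    assume "\<not> inner (y - y') (x - x') + (- \<mu>) * (norm (x - x'))\<^sup>2 \<ge> 0"
    then have "inner (y - y') (x - x') < \<mu> * (norm (x - x'))\<^sup>2" by simp
    moreover have w: "w = (y - y') + \<sigma> *\<^sub>R (x - x')" by (simp add: w_def z_def algebra_simps)
    have "inner (x - x') w = inner (y - y') (x - x') + \<sigma> * (norm (x - x'))\<^sup>2"
      unfolding w inner_add_right inner_scaleR_right power2_norm_eq_inner by (simp only: inner_commute)
    ultimately have "inner (x - x') w < (\<sigma> + \<mu>) * (norm (x - x'))\<^sup>2"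
      by (simp add: distrib_right)
    then have far: "norm p < norm ((x - x') - p)" unfolding farther_iff .
    define c where "c s = J (z + s *\<^sub>R w)" for s
    have line: "z + s *\<^sub>R w \<in> ball (yb + \<sigma> *\<^sub>R xb) r" if "0 \<le> s" "s \<le> 1" for s
    proof -
      have eq: "z + s *\<^sub>R w = (1 - s) *\<^sub>R z + s *\<^sub>R (y + \<sigma> *\<^sub>R x)" by (simp add: w_def algebra_simps)
      have "z \<in> ball (yb + \<sigma> *\<^sub>R xb) r" "y + \<sigma> *\<^sub>R x \<in> ball (yb + \<sigma> *\<^sub>R xb) r"
        using xy xy' by (auto simp: W_def z_def)
      then show ?thesis unfolding eq using that by (intro convexD[OF convex_ball]) auto
    qed
    have lip: "(1 / \<sigma> * norm w)-lipschitz_on {0..1} c"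
    proof (rule lipschitz_onI)
      fix s s' :: real
      have "dist (c s) (c s') \<le> 1 / \<sigma> * dist (z + s *\<^sub>R w) (z + s' *\<^sub>R w)"
        unfolding c_def J_def by (rule lipschitz_onD[OF resolvent_lipschitz[OF T \<sigma>(1)]]) auto
      also have "dist (z + s *\<^sub>R w) (z + s' *\<^sub>R w) = norm w * dist s s'"
        by (simp add: dist_norm flip: scaleR_diff_left)
      finally show "dist (c s) (c s') \<le> 1 / \<sigma> * norm w * dist s s'" by simp
    qed (use \<sigma> in simp)
    have mean: "slope c 0 1 = x - x'"
      using J_eq xy xy' by (simp add: slope_def c_def w_def z_def)
    have gap: "(norm ((x - x') - p) - norm p) / 2 > 0" using far by simp
    obtain t u s where t: "0 \<le> t" "t < 1" "\<forall>n. 0 < s n \<and> t + s n \<le> 1" "s \<longlonglongrightarrow> 0"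
      "(\<lambda>n. slope c t (t + s n)) \<longlonglongrightarrow> u"
      "norm (slope c 0 1 - p) \<le> norm (u - p) + (norm ((x - x') - p) - norm p) / 2"
      by (rule lipschitz_curve_sequential_derivative[OF lip zero_less_one gap, of p])
        (rule that; assumption)
    have "norm p < norm (u - p)" using t(6) far unfolding mean by (simp add: field_simps)
    then have "inner u w < (\<sigma> + \<mu>) * (norm u)\<^sup>2" unfolding farther_iff .
    moreover have "w - \<sigma> *\<^sub>R u \<in> graphical_derivative F (c t) (z + t *\<^sub>R w - \<sigma> *\<^sub>R c t) u"
      using g_ball(2)[OF line]
      by (intro sequential_derivative_of_resolvent_curve[OF _ t(1,3,4,5)]) (auto simp: g_def c_def)
    then have "inner u (w - \<sigma> *\<^sub>R u) \<ge> \<mu> * (norm u)\<^sup>2"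
      using g_ball(1)[OF line[of t]] t(1,2) by (intro A(2)[of "c t"]) (auto simp: g_def c_def)
    ultimately show False by (simp add: inner_diff_right power2_norm_eq_inner algebra_simps)
  qed
  then have "monotone_set (shear (- \<mu>) ` (T \<inter> W))" unfolding monotone_set_shear_iff by blast
  ultimately show ?thesis using that by blast
qed

section \<open>Graphical derivatives of shifted and of monotone mappings\<close>

lemma graphical_derivative_plus_scaled_id:
  assumes "v \<in> graphical_derivative (plus_scaled_id F r) x y u"
  shows "v - r *\<^sub>R u \<in> graphical_derivative F x (y - r *\<^sub>R x) u"
proof -
  obtain s us vs where s: "\<And>k::nat. s k > (0::real)" "s \<longlonglongrightarrow> 0" "us \<longlonglongrightarrow> u" "vs \<longlonglongrightarrow> v"
    "\<And>k. (x + s k *\<^sub>R us k, y + s k *\<^sub>R vs k) \<in> gph (plus_scaled_id F r)"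
    using assms unfolding graphical_derivative_def by blast
  have "(x + s k *\<^sub>R us k, (y - r *\<^sub>R x) + s k *\<^sub>R (vs k - r *\<^sub>R us k)) \<in> gph F" for k
    using s(5)[of k] by (simp add: gph_plus_scaled_id shear_image_iff algebra_simps)
  moreover have "(\<lambda>k. vs k - r *\<^sub>R us k) \<longlonglongrightarrow> v - r *\<^sub>R u" using s by (intro tendsto_intros)
  ultimately show ?thesis unfolding graphical_derivative_def using s(1-3) by blast
qed

lemma derivative_lower_definite_around_plus_scaled_id:
  fixes F :: "'a::real_inner \<Rightarrow> 'a set"
  assumes "derivative_lower_definite_around \<kappa> F xb yb"
  shows "derivative_lower_definite_around (\<kappa> + r) (plus_scaled_id F r) xb (yb + r *\<^sub>R xb)"
proof -
  obtain A where A: "(xb, yb) \<in> interior A"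
    "\<And>x y u v. (x, y) \<in> A \<inter> gph F \<Longrightarrow> v \<in> graphical_derivative F x y u \<Longrightarrow> inner u v \<ge> \<kappa> * (norm u)\<^sup>2"
    using assms unfolding derivative_lower_definite_around_def by blast
  define B where "B = shear (- r) -` interior A"
  have "open B" unfolding B_def by (intro open_vimage continuous_on_shear open_interior)
  then have "(xb, yb + r *\<^sub>R xb) \<in> interior B" using A(1) by (simp add: interior_open B_def shear_def)
  moreover have "inner u v \<ge> (\<kappa> + r) * (norm u)\<^sup>2"
    if xy: "(x, y) \<in> B \<inter> gph (plus_scaled_id F r)"
      and v: "v \<in> graphical_derivative (plus_scaled_id F r) x y u" for x y u v
  proof -
    have "(x, y - r *\<^sub>R x) \<in> A \<inter> gph F"
      using xy interior_subset[of A] by (auto simp: B_def shear_def gph_plus_scaled_id)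
    from A(2)[OF this graphical_derivative_plus_scaled_id[OF v]] show ?thesis
      by (simp add: inner_diff_right power2_norm_eq_inner algebra_simps)
  qed
  ultimately show ?thesis unfolding derivative_lower_definite_around_def by blast
qed

text \<open>Divide the monotonicity inequality between the base point and the approximating points by \<open>s\<^sup>2\<close> and
  pass to the limit.\<close>
lemma locally_monotone_imp_derivative_nonneg:
  assumes "locally_monotone_at F xb yb"
  shows "derivative_lower_definite_around 0 F xb yb"
proof -
  obtain U V where UV: "xb \<in> interior U" "yb \<in> interior V" "monotone_set (gph F \<inter> U \<times> V)"
    using assms unfolding locally_monotone_at_def by blast
  define A where "A = interior U \<times> interior V"
  have A: "open A" "A \<subseteq> U \<times> V" "(xb, yb) \<in> A"
    using UV interior_subset unfolding A_def by (auto simp: open_Times)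
  have "inner u v \<ge> 0" if xy: "(x, y) \<in> A \<inter> gph F" and v: "v \<in> graphical_derivative F x y u"
    for x y u v
  proof -
    obtain s us vs where s: "\<And>k::nat. s k > (0::real)" "s \<longlonglongrightarrow> 0" "us \<longlonglongrightarrow> u" "vs \<longlonglongrightarrow> v"
      "\<And>k. (x + s k *\<^sub>R us k, y + s k *\<^sub>R vs k) \<in> gph F"
      using v unfolding graphical_derivative_def by blast
    have "(\<lambda>k. (x + s k *\<^sub>R us k, y + s k *\<^sub>R vs k)) \<longlonglongrightarrow> (x + 0 *\<^sub>R u, y + 0 *\<^sub>R v)"
      by (intro tendsto_intros s)
    then have "\<forall>\<^sub>F k in sequentially. (x + s k *\<^sub>R us k, y + s k *\<^sub>R vs k) \<in> A"
      using A(1) xy by (intro topological_tendstoD) auto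
    then have "\<forall>\<^sub>F k in sequentially. inner (us k) (vs k) \<ge> 0"
    proof eventually_elim
      case (elim k)
      then have "inner (y + s k *\<^sub>R vs k - y) (x + s k *\<^sub>R us k - x) \<ge> 0"
        using s(5)[of k] xy A(2) by (intro monotone_setD[OF UV(3)]) blast+
      then have "s k * (s k * inner (us k) (vs k)) \<ge> 0" by (simp add: inner_commute)
      then show ?case using s(1)[of k] by (simp add: zero_le_mult_iff)
    qed
    then show ?thesis by (rule tendsto_lowerbound[OF tendsto_inner[OF s(3,4)]]) simp
  qed
  with A show ?thesis
    unfolding derivative_lower_definite_around_def by (intro exI[of _ A]) (auto simp: interior_open)
qed

section \<open>The characterization\<close>

theorem corollary3p7:
  fixes F :: "'a::{real_inner, complete_space} \<Rightarrow> 'a set"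
    and xb yb :: 'a
    and \<kappa> :: real
  assumes "(xb, yb) \<in> gph F"
  shows "locally_maximal_monotone_at (plus_scaled_id F (- \<kappa>)) xb (yb - \<kappa> *\<^sub>R xb) \<longleftrightarrow>
           derivative_lower_definite_around \<kappa> F xb yb \<and>
           locally_maximal_hypomonotone_at F xb yb"
proof -
  have mem: "(xb, yb + r *\<^sub>R xb) \<in> gph (plus_scaled_id F r)" for r
    using assms by (simp add: gph_plus_scaled_id shear_image_iff)
  have locmax_iff: "locally_maximal_monotone_at (plus_scaled_id F r) xb (yb + r *\<^sub>R xb) \<longleftrightarrow>
      (\<exists>T. maximal_monotone T \<and> agree_near (xb, yb + r *\<^sub>R xb) (shear r ` gph F) T)" for r
    using locally_maximal_monotone_at_iff_agree_near[OF mem] by (simp add: gph_plus_scaled_id)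
  \<comment> \<open>Local maximal monotonicity passes from one shift to another as soon as the sheared maximal
    monotone set is locally monotone. Both directions are instances.\<close>
  have transfer: "locally_maximal_monotone_at (plus_scaled_id F s) xb (yb + s *\<^sub>R xb)"
    if T: "maximal_monotone T" "agree_near (xb, yb + r *\<^sub>R xb) (shear r ` gph F) T"
      and W: "open W" "(xb, yb + r *\<^sub>R xb) \<in> W" "monotone_set (shear (s - r) ` (T \<inter> W))"
    for r s T W
  proof -
    have "(xb, yb + r *\<^sub>R xb) \<in> T"
      using T(2) mem[of r] unfolding agree_near_def gph_plus_scaled_id by blast
    then obtain T' where T': "maximal_monotone T'"
      "agree_near (xb, yb + r *\<^sub>R xb + (s - r) *\<^sub>R xb) (shear (s - r) ` T) T'"
      using locally_monotone_shear_agrees_near_maximal[OF T(1) _ W] by blast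
    have base: "yb + r *\<^sub>R xb + (s - r) *\<^sub>R xb = yb + s *\<^sub>R xb" by (simp add: algebra_simps)
    have "agree_near (xb, yb + s *\<^sub>R xb) (shear s ` gph F) (shear (s - r) ` T)"
      using agree_near_shear[OF T(2), of "s - r"] by (simp add: shear_shear_image base)
    with T' show ?thesis unfolding locmax_iff base by (blast intro: agree_near_trans)
  qed
  have base: "yb - \<kappa> *\<^sub>R xb = yb + (- \<kappa>) *\<^sub>R xb" by simp
  show ?thesis
  proof (intro iffI conjI)
    assume L: "locally_maximal_monotone_at (plus_scaled_id F (- \<kappa>)) xb (yb - \<kappa> *\<^sub>R xb)"
    have F: "plus_scaled_id (plus_scaled_id F (- \<kappa>)) \<kappa> = F"
      by (auto simp: mem_plus_scaled_id_iff fun_eq_iff)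
    show "derivative_lower_definite_around \<kappa> F xb yb"
      using derivative_lower_definite_around_plus_scaled_id[of 0 _ xb "yb - \<kappa> *\<^sub>R xb" \<kappa>,
          OF locally_monotone_imp_derivative_nonneg[OF
            locally_maximal_monotone_at_imp_locally_monotone_at[OF L]]]
      by (simp add: F)
    obtain T where T: "maximal_monotone T"
      "agree_near (xb, yb + (- \<kappa>) *\<^sub>R xb) (shear (- \<kappa>) ` gph F) T"
      using L unfolding base locmax_iff by blast
    define \<rho> where "\<rho> = \<bar>\<kappa>\<bar> + 1"
    have "monotone_set (shear (\<rho> - - \<kappa>) ` (T \<inter> UNIV))"
      unfolding monotone_set_shear_iff
    proof clarify
      fix x y x' y' assume "(x, y) \<in> T" "(x', y') \<in> T"
      then have "inner (y - y') (x - x') \<ge> 0"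
        using T(1) unfolding maximal_monotone_def by (blast intro: monotone_setD)
      moreover have "(\<rho> - - \<kappa>) * (norm (x - x'))\<^sup>2 \<ge> 0"
        by (intro mult_nonneg_nonneg) (auto simp: \<rho>_def)
      ultimately show "inner (y - y') (x - x') + (\<rho> - - \<kappa>) * (norm (x - x'))\<^sup>2 \<ge> 0" by linarith
    qed
    then have "locally_maximal_monotone_at (plus_scaled_id F \<rho>) xb (yb + \<rho> *\<^sub>R xb)"
      by (intro transfer[OF T, of UNIV]) auto
    moreover have "\<rho> > 0" by (simp add: \<rho>_def)
    ultimately show "locally_maximal_hypomonotone_at F xb yb"
      unfolding locally_maximal_hypomonotone_at_def by blast
  next
    assume R: "derivative_lower_definite_around \<kappa> F xb yb \<and> locally_maximal_hypomonotone_at F xb yb"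
    then obtain \<rho> T where T: "maximal_monotone T"
      "agree_near (xb, yb + \<rho> *\<^sub>R xb) (shear \<rho> ` gph F) T"
      unfolding locally_maximal_hypomonotone_at_def locmax_iff by blast
    have "(xb, yb + \<rho> *\<^sub>R xb) \<in> T"
      using T(2) mem[of \<rho>] unfolding agree_near_def gph_plus_scaled_id by blast
    moreover have "agree_near (xb, yb + \<rho> *\<^sub>R xb) (gph (plus_scaled_id F \<rho>)) T"
      using T(2) by (simp add: gph_plus_scaled_id)
    moreover have "derivative_lower_definite_around (\<kappa> + \<rho>) (plus_scaled_id F \<rho>) xb (yb + \<rho> *\<^sub>R xb)"
      using R by (intro derivative_lower_definite_around_plus_scaled_id) simp
    ultimately obtain W where "open W" "(xb, yb + \<rho> *\<^sub>R xb) \<in> W"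
      "monotone_set (shear (- (\<kappa> + \<rho>)) ` (T \<inter> W))"
      using lower_definite_derivative_imp_locally_monotone_shear[OF T(1)] by blast
    then show "locally_maximal_monotone_at (plus_scaled_id F (- \<kappa>)) xb (yb - \<kappa> *\<^sub>R xb)"
      unfolding base by (intro transfer[OF T]) (simp_all add: algebra_simps)
  qed
qed

end
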